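(* Let $\Gamma$ be a profinite group and let $$1 \to (F_1 \to G_1) \xrightarrow{i} (F_2 \to G_2) \xrightarrow{j} (F_3 \to G_3) \to 1$$ be an exact sequence of crossed modules with $\Gamma$-action. Then the sequence $$\begin{aligned} 1 &\to \mathbf{H}^{-1}(F_1 \to G_1) \xrightarrow{i_*} \mathbf{H}^{-1}(F_2 \to G_2) \xrightarrow{j_*} \mathbf{H}^{-1}(F_3 \to G_3)\\ &\xrightarrow{\delta_{-1}} \mathbf{H}^0(F_1 \to G_1) \xrightarrow{i_*} \mathbf{H}^0(F_2 \to G_2) \xrightarrow{j_*} \mathbf{H}^0(F_3 \to G_3)\\ &\xrightarrow{\delta_0} \mathbf{H}^1(F_1 \to G_1) \xrightarrow{i_*} \mathbf{H}^1(F_2 \to G_2) \xrightarrow{j_*} \mathbf{H}^1(F_3 \to G_3) \end{aligned}$$ is defined and exact.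
   Context: $\Gamma$ is a profinite group. A $\Gamma$-group is a (discrete, possibly non-abelian) group with a left action of $\Gamma$ by automorphisms, written $(\sigma,g)\mapsto {}^{\sigma}g$, with open stabilizers. $\operatorname{Maps}(\Gamma,F)$ and $\operatorname{Maps}(\Gamma\times\Gamma,F)$ denote the sets of continuous maps ($F$ discrete). A crossed module is a group homomorphism $\alpha\colon F\to G$ with a left action of $G$ on $F$ by automorphisms, $(g,f)\mapsto{}^{g}f$, such that $ff'f^{-1}={}^{\alpha(f)}f'$ and $\alpha({}^{g}f)=g\,\alpha(f)\,g^{-1}$. It has a $\Gamma$-action if $F$ and $G$ are $\Gamma$-groups, $\alpha({}^{\sigma}f)={}^{\sigma}(\alpha(f))$ and ${}^{\sigma}({}^{g}f)={}^{({}^{\sigma}g)}({}^{\sigma}f)$. A morphism $\varepsilon$ of crossed modules with $\Gamma$-action is a pair of $\Gamma$-equivariant homomorphisms $\varepsilon_{-1}\colon F_1\to F_2$, $\varepsilon_0\colon G_1\to G_2$ with $\alpha_2\varepsilon_{-1}=\varepsilon_0\alpha_1$ and $\varepsilon_{-1}({}^{g}f)={}^{\varepsilon_0(g)}\varepsilon_{-1}(f)$. An exact sequence of crossed modules with $\Gamma$-action as in the claim means that $i,j$ are such morphisms and that $1\to F_1\to F_2\to F_3\to1$ and $1\to G_1\to G_2\to G_3\to1$ are exact. We regard $F_1\subset F_2$, $G_1\subset G_2$ as subgroups. Write $\alpha_k\colon F_k\to G_k$. Hypercohomology of a crossed module $\alpha\colon F\to G$ with $\Gamma$-action: (a) $\mathbf{H}^{-1}(F\to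 G)=(\ker\alpha)^{\Gamma}$, a group. (b) $C^0=\operatorname{Maps}(\Gamma,F)\times G$ with group law $(\varphi_1,g_1)(\varphi_2,g_2)=({}^{g_1}\varphi_2\cdot\varphi_1,\,g_1g_2)$. $Z^0\subset C^0$ is the subgroup of pairs $(\varphi,g)$ with $\varphi(\sigma\tau)=\varphi(\sigma)\cdot{}^{\sigma}\varphi(\tau)$ and ${}^{\sigma}g=\alpha(\varphi(\sigma)^{-1})\cdot g$. $F$ acts on $Z^0$ on the right by $(\varphi,g)*f=(\varphi',g')$, $\varphi'(\sigma)=f^{-1}\varphi(\sigma)\,{}^{\sigma}f$, $g'=\alpha(f)^{-1}g$. $\mathbf{H}^0(F\to G)=Z^0/F$, a group with the induced group law and neutral element $\mathrm{Cl}(1,1)$. (c) $Z^1$ is the set of pairs $(h,\psi)\in\operatorname{Maps}(\Gamma\times\Gamma,F)\times\operatorname{Maps}(\Gamma,G)$ with $\psi(\sigma)\cdot{}^{\sigma}\psi(\tau)=\alpha(h(\sigma,\tau))^{-1}\cdot\psi(\sigma\tau)$ and $h(\sigma,\tau\upsilon)\cdot{}^{\psi(\sigma)\sigma}h(\tau,\upsilon)=h(\sigma\tau,\upsilon)\cdot h(\sigma,\tau)$, where ${}^{\psi(\sigma)\sigma}x={}^{\psi(\sigma)}({}^{\sigma}x)$. $C^0$ acts on $Z^1$ on the right by $(h,\psi)*(a,g)=(h',\psi')$, $\psi'(\sigma)=g^{-1}\alpha(a(\sigma))\psi(\sigma)\,{}^{\sigma}g$, $h'(\sigma,\tau)={}^{g^{-1}}\bigl[a(\sigma\tau)\,h(\sigma,\tau)\cdot{}^{\psi(\sigma)\sigma}a(\tau)^{-1}\cdot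 a(\sigma)^{-1}\bigr]$. $\mathbf{H}^1(F\to G)=Z^1/C^0$, a pointed set with neutral element $\mathrm{Cl}(1,1)$. $\mathrm{Cl}$ denotes the class of a cocycle; $i_*,j_*$ are induced by applying $i,j$ to cocycles. Connecting maps. For $f_3\in(\ker\alpha_3)^{\Gamma}$ choose a lift $f\in F_2$; then $\delta_{-1}(f_3)=\mathrm{Cl}(\varphi_1,g_1)$ with $\varphi_1(\sigma)=f\cdot{}^{\sigma}f^{-1}$, $g_1=\alpha_2(f)$. For $\xi_3=\mathrm{Cl}(\varphi_3,g_3)\in\mathbf{H}^0(F_3\to G_3)$ choose a lift $(\varphi,g)\in\operatorname{Maps}(\Gamma,F_2)\times G_2$ of $(\varphi_3,g_3)$; then $\delta_0(\xi_3)=\mathrm{Cl}(h_1,\psi_1)$ with $\psi_1(\sigma)=g^{-1}\alpha_2(\varphi(\sigma))\,{}^{\sigma}g$ and $h_1(\sigma,\tau)={}^{g^{-1}}[\varphi(\sigma\tau)\cdot{}^{\sigma}\varphi(\tau)^{-1}\cdot\varphi(\sigma)^{-1}]$. "Defined" means that these classes lie in the indicated sets and do not depend on choices. Exactness is in the sense of pointed sets: the image of each map equals the preimage of the neutral element under the next map (and the initial $1$ means that the first map has trivial kernel). *)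

theory Defs
  imports "HOL-Analysis.Analysis" "HOL-Algebra.Group_Action" "HOL-Algebra.Exact_Sequence"
begin

section \<open>Profinite groups and discrete groups with continuous action\<close>

record 's top_group = "'s monoid" +
  opens :: "'s topology"

locale profinite_group = group \<Gamma> for \<Gamma> :: "'s top_group" (structure) +
  assumes topspace_eq: "topspace (opens \<Gamma>) = carrier \<Gamma>"
    and continuous_mult:
      "continuous_map (prod_topology (opens \<Gamma>) (opens \<Gamma>)) (opens \<Gamma>) (\<lambda>(\<sigma>, \<tau>). \<sigma> \<otimes> \<tau>)"
    and continuous_inv: "continuous_map (opens \<Gamma>) (opens \<Gamma>) (\<lambda>\<sigma>. inv \<sigma>)"
    and compact: "compact_space (opens \<Gamma>)"
    and Hausdorff: "Hausdorff_space (opens \<Gamma>)"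
    and totally_disconnected:
      "\<And>\<sigma>. \<sigma> \<in> carrier \<Gamma> \<Longrightarrow> connected_component_of_set (opens \<Gamma>) \<sigma> = {\<sigma>}"

text \<open>
  A left action of \<open>G\<close> on \<open>A\<close> by automorphisms is a homomorphism from \<open>G\<close> to \<^const>\<open>AutoGroup\<close> \<open>A\<close>.
  The elements of \<^const>\<open>AutoGroup\<close> are extensional functions; this only fixes the junk values outside
  the carrier of \<open>A\<close>.
\<close>

definition acts_by_auts :: "('g, 'm) monoid_scheme \<Rightarrow> 'a monoid \<Rightarrow> ('g \<Rightarrow> 'a \<Rightarrow> 'a) \<Rightarrow> bool" where
  "acts_by_auts G A a \<longleftrightarrow> a \<in> hom G (AutoGroup A)"

definition is_Gamma_group :: "'s top_group \<Rightarrow> 'a monoid \<Rightarrow> ('s \<Rightarrow> 'a \<Rightarrow> 'a) \<Rightarrow> bool" where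
  "is_Gamma_group \<Gamma> A a \<longleftrightarrow> group A \<and> acts_by_auts \<Gamma> A a \<and>
     (\<forall>x\<in>carrier A. openin (opens \<Gamma>) (stabilizer \<Gamma> a x))"

text \<open>Maps are taken extensional, so that equality of functions is equality of maps on \<open>X\<close>.\<close>

definition Maps :: "'x topology \<Rightarrow> 'a monoid \<Rightarrow> ('x \<Rightarrow> 'a) set" where
  "Maps X A = {f \<in> extensional (topspace X). continuous_map X (discrete_topology (carrier A)) f}"


section \<open>Crossed modules with action\<close>

text \<open>
  \<open>bd\<close> is \<open>\<alpha> : F \<rightarrow> G\<close>, \<open>act\<close> is the action of \<open>G\<close> on \<open>F\<close>, and \<open>actF\<close>, \<open>actG\<close> are the actions of
  \<open>\<Gamma>\<close> on \<open>F\<close> and \<open>G\<close>.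
\<close>

record ('s, 'f, 'g) xmod =
  FF :: "'f monoid"
  GG :: "'g monoid"
  bd :: "'f \<Rightarrow> 'g"
  act :: "'g \<Rightarrow> 'f \<Rightarrow> 'f"
  actF :: "'s \<Rightarrow> 'f \<Rightarrow> 'f"
  actG :: "'s \<Rightarrow> 'g \<Rightarrow> 'g"

definition crossed_module :: "('s, 'f, 'g) xmod \<Rightarrow> bool" where
  "crossed_module M \<longleftrightarrow>
     group (FF M) \<and> group (GG M) \<and>
     bd M \<in> hom (FF M) (GG M) \<and>
     acts_by_auts (GG M) (FF M) (act M) \<and>
     (\<forall>f\<in>carrier (FF M). \<forall>f'\<in>carrier (FF M).
        f \<otimes>\<^bsub>FF M\<^esub> f' \<otimes>\<^bsub>FF M\<^esub> inv\<^bsub>FF M\<^esub> f = act M (bd M f) f') \<and>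
     (\<forall>g\<in>carrier (GG M). \<forall>f\<in>carrier (FF M).
        bd M (act M g f) = g \<otimes>\<^bsub>GG M\<^esub> bd M f \<otimes>\<^bsub>GG M\<^esub> inv\<^bsub>GG M\<^esub> g)"

definition crossed_module_with_action :: "'s top_group \<Rightarrow> ('s, 'f, 'g) xmod \<Rightarrow> bool" where
  "crossed_module_with_action \<Gamma> M \<longleftrightarrow>
     crossed_module M \<and>
     is_Gamma_group \<Gamma> (FF M) (actF M) \<and>
     is_Gamma_group \<Gamma> (GG M) (actG M) \<and>
     (\<forall>\<sigma>\<in>carrier \<Gamma>. \<forall>f\<in>carrier (FF M). bd M (actF M \<sigma> f) = actG M \<sigma> (bd M f)) \<and>
     (\<forall>\<sigma>\<in>carrier \<Gamma>. \<forall>g\<in>carrier (GG M). \<forall>f\<in>carrier (FF M).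
        actF M \<sigma> (act M g f) = act M (actG M \<sigma> g) (actF M \<sigma> f))"

text \<open>\<open>onF\<close> and \<open>onG\<close> are the components in degrees \<open>-1\<close> and \<open>0\<close>.\<close>

record ('f1, 'g1, 'f2, 'g2) xmod_mor =
  onF :: "'f1 \<Rightarrow> 'f2"
  onG :: "'g1 \<Rightarrow> 'g2"

definition is_xmod_mor ::
    "'s top_group \<Rightarrow> ('s, 'f1, 'g1) xmod \<Rightarrow> ('s, 'f2, 'g2) xmod \<Rightarrow>
     ('f1, 'g1, 'f2, 'g2) xmod_mor \<Rightarrow> bool" where
  "is_xmod_mor \<Gamma> M N e \<longleftrightarrow>
     onF e \<in> hom (FF M) (FF N) \<and>
     onG e \<in> hom (GG M) (GG N) \<and>
     (\<forall>\<sigma>\<in>carrier \<Gamma>. \<forall>f\<in>carrier (FF M). onF e (actF M \<sigma> f) = actF N \<sigma> (onF e f)) \<and>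
     (\<forall>\<sigma>\<in>carrier \<Gamma>. \<forall>g\<in>carrier (GG M). onG e (actG M \<sigma> g) = actG N \<sigma> (onG e g)) \<and>
     (\<forall>f\<in>carrier (FF M). bd N (onF e f) = onG e (bd M f)) \<and>
     (\<forall>g\<in>carrier (GG M). \<forall>f\<in>carrier (FF M). onF e (act M g f) = act N (onG e g) (onF e f))"

text \<open>The library's \<^const>\<open>short_exact_sequence\<close> requires all groups to have the same type.\<close>

definition short_exact ::
    "'a monoid \<Rightarrow> 'b monoid \<Rightarrow> 'c monoid \<Rightarrow> ('a \<Rightarrow> 'b) \<Rightarrow> ('b \<Rightarrow> 'c) \<Rightarrow> bool" where
  "short_exact A B C i j \<longleftrightarrow>
     i \<in> mon A B \<and> j \<in> epi B C \<and> i ` carrier A = kernel B C j"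

definition xmod_exact_sequence ::
    "'s top_group \<Rightarrow> ('s, 'f1, 'g1) xmod \<Rightarrow> ('s, 'f2, 'g2) xmod \<Rightarrow> ('s, 'f3, 'g3) xmod \<Rightarrow>
     ('f1, 'g1, 'f2, 'g2) xmod_mor \<Rightarrow> ('f2, 'g2, 'f3, 'g3) xmod_mor \<Rightarrow> bool" where
  "xmod_exact_sequence \<Gamma> M1 M2 M3 i j \<longleftrightarrow>
     crossed_module_with_action \<Gamma> M1 \<and>
     crossed_module_with_action \<Gamma> M2 \<and>
     crossed_module_with_action \<Gamma> M3 \<and>
     is_xmod_mor \<Gamma> M1 M2 i \<and> is_xmod_mor \<Gamma> M2 M3 j \<and>
     short_exact (FF M1) (FF M2) (FF M3) (onF i) (onF j) \<and>
     short_exact (GG M1) (GG M2) (GG M3) (onG i) (onG j)"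


section \<open>Hypercohomology\<close>

definition Hm1 :: "'s top_group \<Rightarrow> ('s, 'f, 'g) xmod \<Rightarrow> 'f monoid" where
  "Hm1 \<Gamma> M = (FF M)\<lparr>carrier :=
     {f \<in> kernel (FF M) (GG M) (bd M). \<forall>\<sigma>\<in>carrier \<Gamma>. actF M \<sigma> f = f}\<rparr>"

definition C0 :: "'s top_group \<Rightarrow> ('s, 'f, 'g) xmod \<Rightarrow> (('s \<Rightarrow> 'f) \<times> 'g) monoid" where
  "C0 \<Gamma> M = \<lparr>
     carrier = Maps (opens \<Gamma>) (FF M) \<times> carrier (GG M),
     mult = (\<lambda>(\<phi>1, g1) (\<phi>2, g2).
       (\<lambda>\<sigma>\<in>carrier \<Gamma>. act M g1 (\<phi>2 \<sigma>) \<otimes>\<^bsub>FF M\<^esub> \<phi>1 \<sigma>, g1 \<otimes>\<^bsub>GG M\<^esub> g2)),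
     one = (\<lambda>\<sigma>\<in>carrier \<Gamma>. \<one>\<^bsub>FF M\<^esub>, \<one>\<^bsub>GG M\<^esub>)\<rparr>"

definition Z0 :: "'s top_group \<Rightarrow> ('s, 'f, 'g) xmod \<Rightarrow> (('s \<Rightarrow> 'f) \<times> 'g) set" where
  "Z0 \<Gamma> M = {(\<phi>, g) \<in> carrier (C0 \<Gamma> M).
     (\<forall>\<sigma>\<in>carrier \<Gamma>. \<forall>\<tau>\<in>carrier \<Gamma>.
        \<phi> (\<sigma> \<otimes>\<^bsub>\<Gamma>\<^esub> \<tau>) = \<phi> \<sigma> \<otimes>\<^bsub>FF M\<^esub> actF M \<sigma> (\<phi> \<tau>)) \<and>
     (\<forall>\<sigma>\<in>carrier \<Gamma>. actG M \<sigma> g = bd M (inv\<^bsub>FF M\<^esub> (\<phi> \<sigma>)) \<otimes>\<^bsub>GG M\<^esub> g)}"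

definition F_act_Z0 ::
    "'s top_group \<Rightarrow> ('s, 'f, 'g) xmod \<Rightarrow> ('s \<Rightarrow> 'f) \<times> 'g \<Rightarrow> 'f \<Rightarrow> ('s \<Rightarrow> 'f) \<times> 'g" where
  "F_act_Z0 \<Gamma> M = (\<lambda>(\<phi>, g) f.
     (\<lambda>\<sigma>\<in>carrier \<Gamma>. inv\<^bsub>FF M\<^esub> f \<otimes>\<^bsub>FF M\<^esub> \<phi> \<sigma> \<otimes>\<^bsub>FF M\<^esub> actF M \<sigma> f,
      inv\<^bsub>GG M\<^esub> (bd M f) \<otimes>\<^bsub>GG M\<^esub> g))"

definition Cl0 ::
    "'s top_group \<Rightarrow> ('s, 'f, 'g) xmod \<Rightarrow> ('s \<Rightarrow> 'f) \<times> 'g \<Rightarrow> (('s \<Rightarrow> 'f) \<times> 'g) set" where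
  "Cl0 \<Gamma> M z = F_act_Z0 \<Gamma> M z ` carrier (FF M)"

text \<open>
  The induced group law is the product of subsets of \<open>C0\<close>, as in the library's quotient
  \<^const>\<open>FactGroup\<close>.
\<close>

definition H0 :: "'s top_group \<Rightarrow> ('s, 'f, 'g) xmod \<Rightarrow> (('s \<Rightarrow> 'f) \<times> 'g) set monoid" where
  "H0 \<Gamma> M = \<lparr>
     carrier = Cl0 \<Gamma> M ` Z0 \<Gamma> M,
     mult = set_mult (C0 \<Gamma> M),
     one = Cl0 \<Gamma> M (\<one>\<^bsub>C0 \<Gamma> M\<^esub>)\<rparr>"

definition Z1 ::
    "'s top_group \<Rightarrow> ('s, 'f, 'g) xmod \<Rightarrow> (('s \<times> 's \<Rightarrow> 'f) \<times> ('s \<Rightarrow> 'g)) set" where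
  "Z1 \<Gamma> M = {(h, \<psi>) \<in> Maps (prod_topology (opens \<Gamma>) (opens \<Gamma>)) (FF M) \<times> Maps (opens \<Gamma>) (GG M).
     (\<forall>\<sigma>\<in>carrier \<Gamma>. \<forall>\<tau>\<in>carrier \<Gamma>.
        \<psi> \<sigma> \<otimes>\<^bsub>GG M\<^esub> actG M \<sigma> (\<psi> \<tau>)
          = inv\<^bsub>GG M\<^esub> (bd M (h (\<sigma>, \<tau>))) \<otimes>\<^bsub>GG M\<^esub> \<psi> (\<sigma> \<otimes>\<^bsub>\<Gamma>\<^esub> \<tau>)) \<and>
     (\<forall>\<sigma>\<in>carrier \<Gamma>. \<forall>\<tau>\<in>carrier \<Gamma>. \<forall>\<upsilon>\<in>carrier \<Gamma>.
        h (\<sigma>, \<tau> \<otimes>\<^bsub>\<Gamma>\<^esub> \<upsilon>) \<otimes>\<^bsub>FF M\<^esub> act M (\<psi> \<sigma>) (actF M \<sigma> (h (\<tau>, \<upsilon>)))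
          = h (\<sigma> \<otimes>\<^bsub>\<Gamma>\<^esub> \<tau>, \<upsilon>) \<otimes>\<^bsub>FF M\<^esub> h (\<sigma>, \<tau>))}"

definition one1 :: "'s top_group \<Rightarrow> ('s, 'f, 'g) xmod \<Rightarrow> ('s \<times> 's \<Rightarrow> 'f) \<times> ('s \<Rightarrow> 'g)" where
  "one1 \<Gamma> M = (\<lambda>x\<in>carrier \<Gamma> \<times> carrier \<Gamma>. \<one>\<^bsub>FF M\<^esub>, \<lambda>\<sigma>\<in>carrier \<Gamma>. \<one>\<^bsub>GG M\<^esub>)"

definition C0_act_Z1 ::
    "'s top_group \<Rightarrow> ('s, 'f, 'g) xmod \<Rightarrow> ('s \<times> 's \<Rightarrow> 'f) \<times> ('s \<Rightarrow> 'g) \<Rightarrow>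
     ('s \<Rightarrow> 'f) \<times> 'g \<Rightarrow> ('s \<times> 's \<Rightarrow> 'f) \<times> ('s \<Rightarrow> 'g)" where
  "C0_act_Z1 \<Gamma> M = (\<lambda>(h, \<psi>) (a, g).
     (\<lambda>(\<sigma>, \<tau>)\<in>carrier \<Gamma> \<times> carrier \<Gamma>.
        act M (inv\<^bsub>GG M\<^esub> g)
          (a (\<sigma> \<otimes>\<^bsub>\<Gamma>\<^esub> \<tau>) \<otimes>\<^bsub>FF M\<^esub> h (\<sigma>, \<tau>)
             \<otimes>\<^bsub>FF M\<^esub> act M (\<psi> \<sigma>) (actF M \<sigma> (inv\<^bsub>FF M\<^esub> (a \<tau>))) \<otimes>\<^bsub>FF M\<^esub> inv\<^bsub>FF M\<^esub> (a \<sigma>)),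
      \<lambda>\<sigma>\<in>carrier \<Gamma>.
        inv\<^bsub>GG M\<^esub> g \<otimes>\<^bsub>GG M\<^esub> bd M (a \<sigma>) \<otimes>\<^bsub>GG M\<^esub> \<psi> \<sigma> \<otimes>\<^bsub>GG M\<^esub> actG M \<sigma> g))"

definition Cl1 ::
    "'s top_group \<Rightarrow> ('s, 'f, 'g) xmod \<Rightarrow> ('s \<times> 's \<Rightarrow> 'f) \<times> ('s \<Rightarrow> 'g) \<Rightarrow>
     (('s \<times> 's \<Rightarrow> 'f) \<times> ('s \<Rightarrow> 'g)) set" where
  "Cl1 \<Gamma> M z = C0_act_Z1 \<Gamma> M z ` carrier (C0 \<Gamma> M)"

definition H1 ::
    "'s top_group \<Rightarrow> ('s, 'f, 'g) xmod \<Rightarrow> (('s \<times> 's \<Rightarrow> 'f) \<times> ('s \<Rightarrow> 'g)) set set" where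
  "H1 \<Gamma> M = Cl1 \<Gamma> M ` Z1 \<Gamma> M"

definition neutral1 ::
    "'s top_group \<Rightarrow> ('s, 'f, 'g) xmod \<Rightarrow> (('s \<times> 's \<Rightarrow> 'f) \<times> ('s \<Rightarrow> 'g)) set" where
  "neutral1 \<Gamma> M = Cl1 \<Gamma> M (one1 \<Gamma> M)"


section \<open>Induced maps\<close>

text \<open>
  A map out of a set of classes is given by the set of values it takes for all possible choices
  (of representatives, and of lifts for the connecting maps). It is defined when all the
  cochains involved are cocycles and the set of values is a singleton; the map itself
  is then the unique element of this set.
\<close>

definition push0 ::
    "'s top_group \<Rightarrow> ('f1, 'g1, 'f2, 'g2) xmod_mor \<Rightarrow> ('s \<Rightarrow> 'f1) \<times> 'g1 \<Rightarrow> ('s \<Rightarrow> 'f2) \<times> 'g2" where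
  "push0 \<Gamma> e = (\<lambda>(\<phi>, g). (\<lambda>\<sigma>\<in>carrier \<Gamma>. onF e (\<phi> \<sigma>), onG e g))"

definition push1 ::
    "'s top_group \<Rightarrow> ('f1, 'g1, 'f2, 'g2) xmod_mor \<Rightarrow>
     ('s \<times> 's \<Rightarrow> 'f1) \<times> ('s \<Rightarrow> 'g1) \<Rightarrow> ('s \<times> 's \<Rightarrow> 'f2) \<times> ('s \<Rightarrow> 'g2)" where
  "push1 \<Gamma> e = (\<lambda>(h, \<psi>).
     (\<lambda>x\<in>carrier \<Gamma> \<times> carrier \<Gamma>. onF e (h x), \<lambda>\<sigma>\<in>carrier \<Gamma>. onG e (\<psi> \<sigma>)))"

definition Hm1_map :: "('f1, 'g1, 'f2, 'g2) xmod_mor \<Rightarrow> 'f1 \<Rightarrow> 'f2" where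
  "Hm1_map e = onF e"

definition Hm1_map_defined ::
    "'s top_group \<Rightarrow> ('s, 'f1, 'g1) xmod \<Rightarrow> ('s, 'f2, 'g2) xmod \<Rightarrow>
     ('f1, 'g1, 'f2, 'g2) xmod_mor \<Rightarrow> bool" where
  "Hm1_map_defined \<Gamma> M N e \<longleftrightarrow> Hm1_map e \<in> carrier (Hm1 \<Gamma> M) \<rightarrow> carrier (Hm1 \<Gamma> N)"

definition H0_map ::
    "'s top_group \<Rightarrow> ('s, 'f2, 'g2) xmod \<Rightarrow> ('f1, 'g1, 'f2, 'g2) xmod_mor \<Rightarrow>
     (('s \<Rightarrow> 'f1) \<times> 'g1) set \<Rightarrow> (('s \<Rightarrow> 'f2) \<times> 'g2) set" where
  "H0_map \<Gamma> N e \<xi> = the_elem ((\<lambda>z. Cl0 \<Gamma> N (push0 \<Gamma> e z)) ` \<xi>)"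

definition H0_map_defined ::
    "'s top_group \<Rightarrow> ('s, 'f1, 'g1) xmod \<Rightarrow> ('s, 'f2, 'g2) xmod \<Rightarrow>
     ('f1, 'g1, 'f2, 'g2) xmod_mor \<Rightarrow> bool" where
  "H0_map_defined \<Gamma> M N e \<longleftrightarrow>
     (\<forall>\<xi>\<in>carrier (H0 \<Gamma> M).
        push0 \<Gamma> e ` \<xi> \<subseteq> Z0 \<Gamma> N \<and> is_singleton ((\<lambda>z. Cl0 \<Gamma> N (push0 \<Gamma> e z)) ` \<xi>))"

definition H1_map ::
    "'s top_group \<Rightarrow> ('s, 'f2, 'g2) xmod \<Rightarrow> ('f1, 'g1, 'f2, 'g2) xmod_mor \<Rightarrow>
     (('s \<times> 's \<Rightarrow> 'f1) \<times> ('s \<Rightarrow> 'g1)) set \<Rightarrow> (('s \<times> 's \<Rightarrow> 'f2) \<times> ('s \<Rightarrow> 'g2)) set" where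
  "H1_map \<Gamma> N e \<xi> = the_elem ((\<lambda>z. Cl1 \<Gamma> N (push1 \<Gamma> e z)) ` \<xi>)"

definition H1_map_defined ::
    "'s top_group \<Rightarrow> ('s, 'f1, 'g1) xmod \<Rightarrow> ('s, 'f2, 'g2) xmod \<Rightarrow>
     ('f1, 'g1, 'f2, 'g2) xmod_mor \<Rightarrow> bool" where
  "H1_map_defined \<Gamma> M N e \<longleftrightarrow>
     (\<forall>\<xi>\<in>H1 \<Gamma> M.
        push1 \<Gamma> e ` \<xi> \<subseteq> Z1 \<Gamma> N \<and> is_singleton ((\<lambda>z. Cl1 \<Gamma> N (push1 \<Gamma> e z)) ` \<xi>))"


section \<open>Connecting maps\<close>

text \<open>
  The cochains below take values in the middle crossed module \<open>M2\<close>. The first crossed module is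
  not assumed to consist of literal subgroups, so ``lying in \<open>Z0 \<Gamma> M1\<close>'' means being
  \<open>push0 \<Gamma> i z\<close> for a (necessarily unique) \<open>z \<in> Z0 \<Gamma> M1\<close>; similarly for \<open>Z1\<close>.
\<close>

definition deltam1_cochain ::
    "'s top_group \<Rightarrow> ('s, 'f, 'g) xmod \<Rightarrow> 'f \<Rightarrow> ('s \<Rightarrow> 'f) \<times> 'g" where
  "deltam1_cochain \<Gamma> M2 f =
     (\<lambda>\<sigma>\<in>carrier \<Gamma>. f \<otimes>\<^bsub>FF M2\<^esub> actF M2 \<sigma> (inv\<^bsub>FF M2\<^esub> f), bd M2 f)"

definition lifts_m1 :: "('s, 'f2, 'g2) xmod \<Rightarrow> ('f2, 'g2, 'f3, 'g3) xmod_mor \<Rightarrow> 'f3 \<Rightarrow> 'f2 set" where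
  "lifts_m1 M2 j f3 = {f \<in> carrier (FF M2). onF j f = f3}"

definition deltam1_values ::
    "'s top_group \<Rightarrow> ('s, 'f1, 'g1) xmod \<Rightarrow> ('s, 'f2, 'g2) xmod \<Rightarrow>
     ('f1, 'g1, 'f2, 'g2) xmod_mor \<Rightarrow> ('f2, 'g2, 'f3, 'g3) xmod_mor \<Rightarrow>
     'f3 \<Rightarrow> (('s \<Rightarrow> 'f1) \<times> 'g1) set set" where
  "deltam1_values \<Gamma> M1 M2 i j f3 =
     {Cl0 \<Gamma> M1 z | z f. f \<in> lifts_m1 M2 j f3 \<and> z \<in> Z0 \<Gamma> M1 \<and> push0 \<Gamma> i z = deltam1_cochain \<Gamma> M2 f}"

definition deltam1 ::
    "'s top_group \<Rightarrow> ('s, 'f1, 'g1) xmod \<Rightarrow> ('s, 'f2, 'g2) xmod \<Rightarrow>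
     ('f1, 'g1, 'f2, 'g2) xmod_mor \<Rightarrow> ('f2, 'g2, 'f3, 'g3) xmod_mor \<Rightarrow>
     'f3 \<Rightarrow> (('s \<Rightarrow> 'f1) \<times> 'g1) set" where
  "deltam1 \<Gamma> M1 M2 i j f3 = the_elem (deltam1_values \<Gamma> M1 M2 i j f3)"

definition deltam1_defined ::
    "'s top_group \<Rightarrow> ('s, 'f1, 'g1) xmod \<Rightarrow> ('s, 'f2, 'g2) xmod \<Rightarrow> ('s, 'f3, 'g3) xmod \<Rightarrow>
     ('f1, 'g1, 'f2, 'g2) xmod_mor \<Rightarrow> ('f2, 'g2, 'f3, 'g3) xmod_mor \<Rightarrow> bool" where
  "deltam1_defined \<Gamma> M1 M2 M3 i j \<longleftrightarrow>
     (\<forall>f3\<in>carrier (Hm1 \<Gamma> M3).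
        lifts_m1 M2 j f3 \<noteq> {} \<and>
        (\<forall>f\<in>lifts_m1 M2 j f3. \<exists>z\<in>Z0 \<Gamma> M1. push0 \<Gamma> i z = deltam1_cochain \<Gamma> M2 f) \<and>
        is_singleton (deltam1_values \<Gamma> M1 M2 i j f3))"

definition delta0_cochain ::
    "'s top_group \<Rightarrow> ('s, 'f, 'g) xmod \<Rightarrow> ('s \<Rightarrow> 'f) \<times> 'g \<Rightarrow> ('s \<times> 's \<Rightarrow> 'f) \<times> ('s \<Rightarrow> 'g)" where
  "delta0_cochain \<Gamma> M2 = (\<lambda>(\<phi>, g).
     (\<lambda>(\<sigma>, \<tau>)\<in>carrier \<Gamma> \<times> carrier \<Gamma>.
        act M2 (inv\<^bsub>GG M2\<^esub> g)
          (\<phi> (\<sigma> \<otimes>\<^bsub>\<Gamma>\<^esub> \<tau>) \<otimes>\<^bsub>FF M2\<^esub> actF M2 \<sigma> (inv\<^bsub>FF M2\<^esub> (\<phi> \<tau>)) \<otimes>\<^bsub>FF M2\<^esub> inv\<^bsub>FF M2\<^esub> (\<phi> \<sigma>)),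
      \<lambda>\<sigma>\<in>carrier \<Gamma>. inv\<^bsub>GG M2\<^esub> g \<otimes>\<^bsub>GG M2\<^esub> bd M2 (\<phi> \<sigma>) \<otimes>\<^bsub>GG M2\<^esub> actG M2 \<sigma> g))"

definition lifts_0 ::
    "'s top_group \<Rightarrow> ('s, 'f2, 'g2) xmod \<Rightarrow> ('f2, 'g2, 'f3, 'g3) xmod_mor \<Rightarrow>
     ('s \<Rightarrow> 'f3) \<times> 'g3 \<Rightarrow> (('s \<Rightarrow> 'f2) \<times> 'g2) set" where
  "lifts_0 \<Gamma> M2 j z3 = {c \<in> Maps (opens \<Gamma>) (FF M2) \<times> carrier (GG M2). push0 \<Gamma> j c = z3}"

text \<open>The elements of \<open>\<xi>3\<close> are the cocycles representing it.\<close>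

definition delta0_values ::
    "'s top_group \<Rightarrow> ('s, 'f1, 'g1) xmod \<Rightarrow> ('s, 'f2, 'g2) xmod \<Rightarrow>
     ('f1, 'g1, 'f2, 'g2) xmod_mor \<Rightarrow> ('f2, 'g2, 'f3, 'g3) xmod_mor \<Rightarrow>
     (('s \<Rightarrow> 'f3) \<times> 'g3) set \<Rightarrow> (('s \<times> 's \<Rightarrow> 'f1) \<times> ('s \<Rightarrow> 'g1)) set set" where
  "delta0_values \<Gamma> M1 M2 i j \<xi>3 =
     {Cl1 \<Gamma> M1 z | z c z3. z3 \<in> \<xi>3 \<and> c \<in> lifts_0 \<Gamma> M2 j z3 \<and>
        z \<in> Z1 \<Gamma> M1 \<and> push1 \<Gamma> i z = delta0_cochain \<Gamma> M2 c}"

definition delta0 ::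
    "'s top_group \<Rightarrow> ('s, 'f1, 'g1) xmod \<Rightarrow> ('s, 'f2, 'g2) xmod \<Rightarrow>
     ('f1, 'g1, 'f2, 'g2) xmod_mor \<Rightarrow> ('f2, 'g2, 'f3, 'g3) xmod_mor \<Rightarrow>
     (('s \<Rightarrow> 'f3) \<times> 'g3) set \<Rightarrow> (('s \<times> 's \<Rightarrow> 'f1) \<times> ('s \<Rightarrow> 'g1)) set" where
  "delta0 \<Gamma> M1 M2 i j \<xi>3 = the_elem (delta0_values \<Gamma> M1 M2 i j \<xi>3)"

definition delta0_defined ::
    "'s top_group \<Rightarrow> ('s, 'f1, 'g1) xmod \<Rightarrow> ('s, 'f2, 'g2) xmod \<Rightarrow> ('s, 'f3, 'g3) xmod \<Rightarrow>
     ('f1, 'g1, 'f2, 'g2) xmod_mor \<Rightarrow> ('f2, 'g2, 'f3, 'g3) xmod_mor \<Rightarrow> bool" where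
  "delta0_defined \<Gamma> M1 M2 M3 i j \<longleftrightarrow>
     (\<forall>\<xi>3\<in>carrier (H0 \<Gamma> M3).
        (\<forall>z3\<in>\<xi>3. lifts_0 \<Gamma> M2 j z3 \<noteq> {} \<and>
           (\<forall>c\<in>lifts_0 \<Gamma> M2 j z3. \<exists>z\<in>Z1 \<Gamma> M1. push1 \<Gamma> i z = delta0_cochain \<Gamma> M2 c)) \<and>
        is_singleton (delta0_values \<Gamma> M1 M2 i j \<xi>3))"


section \<open>Exactness of pointed sets\<close>

text \<open>Exactness of \<open>A \<rightarrow> B \<rightarrow> C\<close> at \<open>B\<close>, where \<open>e\<close> is the neutral element of \<open>C\<close>.\<close>

definition exact_at :: "'a set \<Rightarrow> ('a \<Rightarrow> 'b) \<Rightarrow> 'b set \<Rightarrow> ('b \<Rightarrow> 'c) \<Rightarrow> 'c \<Rightarrow> bool" where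
  "exact_at A f B g e \<longleftrightarrow> f ` A = {y \<in> B. g y = e}"

end

theory Submission
  imports Defs
begin

text \<open>
  The group \<open>C0\<close> acts on \<open>Z1\<close>, and \<open>Z0\<close> is precisely the stabilizer of the neutral cocycle; likewise
  \<open>F\<close> acts on \<open>Z0\<close>, and the stabilizer of the neutral element is \<open>Hm1\<close>. For a short exact sequence
  of groups acting on pointed sets such that the first set is the fibre of the second over the base
  point of the third, the stabilizers of the base points and the sets of orbits form a six-term
  exact sequence. Applied to \<open>F\<close> acting on \<open>Z0\<close> and to \<open>C0\<close> acting on \<open>Z1\<close>, this gives the
  two halves of the claim: the cochains defining the connecting maps are the images of the base
  points under the chosen lifts (their inverses, in degree \<open>-1\<close>). To pass from \<open>Z0\<close> to \<open>H0\<close> in the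
  second half, note that \<open>F\<close> acts on \<open>Z0\<close> through left multiplication in \<open>C0\<close> by coboundaries,
  which stabilize the neutral cocycle.
\<close>

section \<open>Exact sequences of groups acting on pointed sets\<close>

text \<open>Two facts carry the abstract argument over to cochains. A map into a discrete group is
  continuous exactly when it is locally constant, so it may be composed with any set-theoretic
  section: continuous cochains lift along a surjection, whatever section is chosen. Cocycles need
  not lift, which is why surjectivity is asked of the acting groups and not of the sets acted on.
  Moreover the fibre of \<open>Z1 \<Gamma> M2\<close> over the neutral cocycle is the image of
  \<open>Z1 \<Gamma> M1\<close> on the nose, not merely up to cohomology, because \<open>i\<close>
  is injective with image the kernel of \<open>j\<close>. Exactness of pointed sets concerns only
  the fibre over the base point, so only the stabilizer of that point enters and no twisting of
  coefficients occurs.\<close>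

locale right_action = group G
  for G :: "('g, 'm) monoid_scheme" (structure) +
  fixes X :: "'x set" and a :: "'x \<Rightarrow> 'g \<Rightarrow> 'x"
  assumes act_closed: "\<And>x g. x \<in> X \<Longrightarrow> g \<in> carrier G \<Longrightarrow> a x g \<in> X"
    and act_one: "\<And>x. x \<in> X \<Longrightarrow> a x \<one> = x"
    and act_mult: "\<And>x g h. x \<in> X \<Longrightarrow> g \<in> carrier G \<Longrightarrow> h \<in> carrier G \<Longrightarrow> a x (g \<otimes> h) = a (a x g) h"
begin

definition orb :: "'x \<Rightarrow> 'x set" where
  "orb x = a x ` carrier G"

definition stab :: "'x \<Rightarrow> 'g set" where
  "stab x = {g \<in> carrier G. a x g = x}"

lemma act_inv_act [simp]: "x \<in> X \<Longrightarrow> g \<in> carrier G \<Longrightarrow> a (a x g) (inv g) = x"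
  using act_mult[of x g "inv g"] act_one by simp

lemma self_in_orb: "x \<in> X \<Longrightarrow> x \<in> orb x"
  unfolding orb_def using act_one one_closed by (metis imageI)

lemma orb_subset: "x \<in> X \<Longrightarrow> orb x \<subseteq> X"
  unfolding orb_def using act_closed by blast

lemma orb_act:
  assumes "x \<in> X" "g \<in> carrier G"
  shows "orb (a x g) = orb x"
proof
  show "orb (a x g) \<subseteq> orb x"
    unfolding orb_def using assms by (auto simp flip: act_mult)
  show "orb x \<subseteq> orb (a x g)"
  proof
    fix y assume "y \<in> orb x"
    then obtain h where h: "h \<in> carrier G" "y = a x h"
      unfolding orb_def by blast
    then have "y = a (a x g) (inv g \<otimes> h)"
      using assms by (simp add: act_mult act_closed)
    then show "y \<in> orb (a x g)"
      unfolding orb_def using h assms by blast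
  qed
qed

lemma orb_eqD: "x \<in> X \<Longrightarrow> y \<in> X \<Longrightarrow> orb x = orb y \<Longrightarrow> \<exists>g\<in>carrier G. y = a x g"
  using self_in_orb[of y] unfolding orb_def by blast

lemma stab_inv: "x \<in> X \<Longrightarrow> g \<in> stab x \<Longrightarrow> inv g \<in> stab x"
  unfolding stab_def using act_inv_act by fastforce

lemma stab_of_act_eq:
  assumes "x \<in> X" "g \<in> carrier G" "h \<in> carrier G" "a x g = a x h"
  shows "g \<otimes> inv h \<in> stab x"
  using assms by (simp add: stab_def act_mult)

end

text \<open>\<open>uv_exact\<close> describes the strict fibre over \<open>b3\<close>. An element
  whose image merely lies in the orbit of \<open>b3\<close> is first moved into this fibre by an
  element of \<open>G2\<close>; that is the purpose of \<open>q_surj\<close>.\<close>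

locale exact_actions =
  A1: right_action G1 X1 a1 + A2: right_action G2 X2 a2 + A3: right_action G3 X3 a3
  for G1 :: "('g1, 'm1) monoid_scheme" and X1 :: "'x1 set" and a1
    and G2 :: "('g2, 'm2) monoid_scheme" and X2 :: "'x2 set" and a2
    and G3 :: "('g3, 'm3) monoid_scheme" and X3 :: "'x3 set" and a3 +
  fixes p :: "'g1 \<Rightarrow> 'g2" and q :: "'g2 \<Rightarrow> 'g3"
    and u :: "'x1 \<Rightarrow> 'x2" and v :: "'x2 \<Rightarrow> 'x3" and b1 :: 'x1 and b2 :: 'x2 and b3 :: 'x3
  assumes p_closed: "\<And>g. g \<in> carrier G1 \<Longrightarrow> p g \<in> carrier G2"
    and q_hom: "q \<in> hom G2 G3"
    and q_surj: "q ` carrier G2 = carrier G3"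
    and pq_exact: "p ` carrier G1 = kernel G2 G3 q"
    and u_closed: "\<And>x. x \<in> X1 \<Longrightarrow> u x \<in> X2"
    and v_closed: "\<And>x. x \<in> X2 \<Longrightarrow> v x \<in> X3"
    and u_act: "\<And>x g. x \<in> X1 \<Longrightarrow> g \<in> carrier G1 \<Longrightarrow> u (a1 x g) = a2 (u x) (p g)"
    and v_act: "\<And>x g. x \<in> X2 \<Longrightarrow> g \<in> carrier G2 \<Longrightarrow> v (a2 x g) = a3 (v x) (q g)"
    and u_inj: "inj_on u X1"
    and b1: "b1 \<in> X1" and u_b1: "u b1 = b2" and v_b2: "v b2 = b3"
    and uv_exact: "u ` X1 = {x \<in> X2. v x = b3}"
begin

sublocale q: group_hom G2 G3 q
  by (intro group_hom.intro group_hom_axioms.intro q_hom A2.is_group A3.is_group)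

lemma b2: "b2 \<in> X2" and b3: "b3 \<in> X3"
  using b1 u_b1 u_closed v_b2 v_closed by auto

text \<open>\<open>connects g x\<close> means that the lift \<open>g\<close> exhibits the orbit of \<open>x\<close> as a value of the
  connecting map from the stabilizer of \<open>b3\<close> to the orbits of \<open>X1\<close>.\<close>

definition connects :: "'g2 \<Rightarrow> 'x1 \<Rightarrow> bool" where
  "connects g x \<longleftrightarrow> g \<in> carrier G2 \<and> x \<in> X1 \<and> u x = a2 b2 g"

lemma orb_v: "x \<in> X2 \<Longrightarrow> y \<in> A2.orb x \<Longrightarrow> A3.orb (v y) = A3.orb (v x)"
  unfolding A2.orb_def using v_act v_closed A3.orb_act by auto

lemma orb_v_eq: "x \<in> X2 \<Longrightarrow> y \<in> X2 \<Longrightarrow> A2.orb x = A2.orb y \<Longrightarrow> A3.orb (v x) = A3.orb (v y)"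
  using orb_v A2.self_in_orb by metis

lemma q_p: "g \<in> carrier G1 \<Longrightarrow> q (p g) = \<one>\<^bsub>G3\<^esub>"
  using pq_exact by (auto simp: kernel_def)

lemma pE:
  assumes "g \<in> carrier G2" "q g = \<one>\<^bsub>G3\<^esub>"
  obtains h where "h \<in> carrier G1" "g = p h"
  using assms pq_exact by (auto simp: kernel_def)

lemma v_u: "x \<in> X1 \<Longrightarrow> v (u x) = b3"
  using uv_exact by blast

text \<open>If \<open>q g\<close> fixes \<open>b3\<close>, then the translate of \<open>b2\<close>
  by \<open>g\<close> stays in the fibre over \<open>b3\<close>, which is the image of
  \<open>u\<close>.\<close>

lemma connects_exists:
  assumes "g \<in> carrier G2" "q g \<in> A3.stab b3"
  shows "\<exists>x. connects g x"
proof -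
  have "a2 b2 g \<in> {x \<in> X2. v x = b3}"
    using assms v_act[OF b2] A2.act_closed[OF b2] v_b2 by (simp add: A3.stab_def)
  then show ?thesis
    using assms uv_exact unfolding connects_def by (metis imageE)
qed

lemma connects_stab: "connects g x \<Longrightarrow> q g \<in> A3.stab b3"
  unfolding connects_def A3.stab_def using v_u v_act[OF b2] v_b2 by fastforce

text \<open>Independence of the lift: two lifts of the same element differ by some
  \<open>p k\<close>, and injectivity of \<open>u\<close> turns translation by \<open>p k\<close> in
  \<open>X2\<close> into translation by \<open>k\<close> in \<open>X1\<close>.\<close>

lemma connects_unique:
  assumes "connects g x" "connects g' x'" "q g = q g'"
  shows "A1.orb x = A1.orb x'"
proof -
  have g: "g \<in> carrier G2" "g' \<in> carrier G2" and x: "x \<in> X1" "x' \<in> X1"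
    and ux: "u x = a2 b2 g" "u x' = a2 b2 g'"
    using assms unfolding connects_def by auto
  have "q (inv\<^bsub>G2\<^esub> g \<otimes>\<^bsub>G2\<^esub> g') = \<one>\<^bsub>G3\<^esub>"
    using g assms(3) by simp
  then obtain k where k: "k \<in> carrier G1" "inv\<^bsub>G2\<^esub> g \<otimes>\<^bsub>G2\<^esub> g' = p k"
    using g by (metis pE A2.m_closed A2.inv_closed)
  have "u (a1 x k) = a2 (a2 b2 g) (inv\<^bsub>G2\<^esub> g \<otimes>\<^bsub>G2\<^esub> g')"
    using k x u_act ux by simp
  also have "\<dots> = u x'"
    using g b2 by (simp add: ux A2.act_mult A2.act_closed)
  finally have "a1 x k = x'"
    using u_inj x k A1.act_closed by (auto dest: inj_onD)
  then show ?thesis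
    using A1.orb_act x k by metis
qed

text \<open>Exactness at the stabilizer of \<open>b3\<close>. If \<open>x\<close> is the translate
  of \<open>b1\<close> by \<open>k\<close>, then \<open>g\<close> and \<open>p k\<close> move
  \<open>b2\<close> to the same point, so \<open>g\<close> times the inverse of \<open>p k\<close>
  stabilizes \<open>b2\<close> and has the same image as \<open>g\<close>. Conversely, an element
  stabilizing \<open>b2\<close> connects to \<open>b1\<close>, and the orbit depends only on the
  image under \<open>q\<close>.\<close>

lemma connects_trivial_iff:
  assumes "connects g x"
  shows "A1.orb x = A1.orb b1 \<longleftrightarrow> q g \<in> q ` A2.stab b2"
proof
  have g: "g \<in> carrier G2" and x: "x \<in> X1" and ux: "u x = a2 b2 g"
    using assms unfolding connects_def by auto
  show "q g \<in> q ` A2.stab b2" if orb: "A1.orb x = A1.orb b1"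
  proof -
    obtain k where k: "k \<in> carrier G1" "x = a1 b1 k"
      using A1.orb_eqD[OF b1 x orb[symmetric]] by (elim bexE)
    then have "a2 b2 g = a2 b2 (p k)"
      using u_act[OF b1 k(1)] u_b1 ux by simp
    then have "g \<otimes>\<^bsub>G2\<^esub> inv\<^bsub>G2\<^esub> (p k) \<in> A2.stab b2"
      using A2.stab_of_act_eq b2 g k p_closed by metis
    moreover have "q (g \<otimes>\<^bsub>G2\<^esub> inv\<^bsub>G2\<^esub> (p k)) = q g"
      using g k p_closed q_p by simp
    ultimately show ?thesis by (metis imageI)
  qed
  show "A1.orb x = A1.orb b1" if "q g \<in> q ` A2.stab b2"
  proof -
    obtain s where s: "s \<in> A2.stab b2" "q g = q s"
      using \<open>q g \<in> q ` A2.stab b2\<close> by blast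
    then have "connects s b1"
      unfolding connects_def A2.stab_def using b1 u_b1 by simp
    then show ?thesis
      using connects_unique assms s by blast
  qed
qed

text \<open>Exactness at the orbits of \<open>X1\<close>: the element of \<open>G2\<close> that
  carries \<open>b2\<close> to \<open>u x\<close> is itself the lift, and
  \<open>connects_stab\<close> says that its image stabilizes \<open>b3\<close>.\<close>

lemma orb_u_trivial_iff:
  assumes "x \<in> X1"
  shows "A2.orb (u x) = A2.orb b2 \<longleftrightarrow> (\<exists>g. connects g x)"
proof
  show "\<exists>g. connects g x" if "A2.orb (u x) = A2.orb b2"
    using A2.orb_eqD[OF b2 u_closed[OF assms] that[symmetric]] assms unfolding connects_def by auto
  show "A2.orb (u x) = A2.orb b2" if "\<exists>g. connects g x"
    using that A2.orb_act[OF b2] unfolding connects_def by auto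
qed

lemma connects_orb_u: "connects g x \<Longrightarrow> A2.orb (u x) = A2.orb b2"
  using orb_u_trivial_iff unfolding connects_def by blast

text \<open>Exactness at the orbits of \<open>X2\<close>: an element of \<open>G3\<close> moving
  \<open>v x\<close> to \<open>b3\<close> is lifted to \<open>G2\<close>, and the lift moves
  \<open>x\<close> into the fibre over \<open>b3\<close> without changing its orbit.\<close>

lemma orb_v_trivial_iff:
  assumes "x \<in> X2"
  shows "A3.orb (v x) = A3.orb b3 \<longleftrightarrow> (\<exists>y\<in>X1. A2.orb (u y) = A2.orb x)"
proof
  show "\<exists>y\<in>X1. A2.orb (u y) = A2.orb x" if orb: "A3.orb (v x) = A3.orb b3"
  proof -
    obtain g3 where g3: "g3 \<in> carrier G3" "b3 = a3 (v x) g3"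
      using A3.orb_eqD[OF v_closed[OF assms] b3 orb] by (elim bexE)
    then have "g3 \<in> q ` carrier G2"
      using q_surj by simp
    then obtain g where g: "g \<in> carrier G2" "q g = g3"
      by auto
    then have "a2 x g \<in> u ` X1"
      unfolding uv_exact using v_act[OF assms g(1)] A2.act_closed[OF assms g(1)] g3(2) by simp
    then obtain y where "y \<in> X1" "u y = a2 x g"
      by auto
    then show ?thesis
      using A2.orb_act[OF assms g(1)] by metis
  qed
  show "A3.orb (v x) = A3.orb b3" if "\<exists>y\<in>X1. A2.orb (u y) = A2.orb x"
    using that orb_v_eq[OF u_closed assms] v_u by force
qed

end

section \<open>Locally constant maps\<close>

text \<open>Continuity into a discrete group is this condition together with membership of the
  values in the carrier. Separating the two lets local constancy pass through arbitrary functions of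
  the values, with no algebraic side conditions.\<close>

definition locally_constant_on :: "'x topology \<Rightarrow> ('x \<Rightarrow> 'a) \<Rightarrow> bool" where
  "locally_constant_on X f \<longleftrightarrow> (\<forall>x\<in>topspace X. \<exists>U. openin X U \<and> x \<in> U \<and> (\<forall>y\<in>U. f y = f x))"

lemma Maps_iff:
  "f \<in> Maps X A \<longleftrightarrow>
     f \<in> extensional (topspace X) \<and> f \<in> topspace X \<rightarrow> carrier A \<and> locally_constant_on X f"
proof -
  have "continuous_map X (discrete_topology (carrier A)) f \<longleftrightarrow> locally_constant_on X f"
    if f: "f \<in> topspace X \<rightarrow> carrier A"
  proof
    assume c: "continuous_map X (discrete_topology (carrier A)) f"
    show "locally_constant_on X f"
      unfolding locally_constant_on_def
    proof
      fix x assume x: "x \<in> topspace X"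
      have "openin (discrete_topology (carrier A)) {f x}"
        using x f by auto
      then have "openin X {y \<in> topspace X. f y \<in> {f x}}"
        using openin_continuous_map_preimage[OF c] by blast
      then show "\<exists>U. openin X U \<and> x \<in> U \<and> (\<forall>y\<in>U. f y = f x)"
        using x by (intro exI[of _ "{y \<in> topspace X. f y \<in> {f x}}"]) simp
    qed
  next
    assume l: "locally_constant_on X f"
    have "openin X {x \<in> topspace X. f x \<in> V}" for V
      unfolding openin_subopen[of _ "{x \<in> topspace X. f x \<in> V}"]
    proof
      fix x assume x: "x \<in> {x \<in> topspace X. f x \<in> V}"
      then obtain U where "openin X U" "x \<in> U" "\<forall>y\<in>U. f y = f x"
        using l unfolding locally_constant_on_def by blast
      then show "\<exists>T. openin X T \<and> x \<in> T \<and> T \<subseteq> {x \<in> topspace X. f x \<in> V}"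
        using x openin_subset by (intro exI[of _ U]) fastforce
    qed
    then show "continuous_map X (discrete_topology (carrier A)) f"
      using f by (simp add: continuous_map_def)
  qed
  moreover have "f \<in> topspace X \<rightarrow> carrier A"
    if "continuous_map X (discrete_topology (carrier A)) f"
    using continuous_map_funspace[OF that] by simp
  ultimately show ?thesis
    unfolding Maps_def by blast
qed

lemma locally_constant_on_const: "locally_constant_on X (\<lambda>x. c)"
  unfolding locally_constant_on_def by blast

lemma locally_constant_on_apply: "locally_constant_on X f \<Longrightarrow> locally_constant_on X (\<lambda>x. k (f x))"
  unfolding locally_constant_on_def by metis

lemma locally_constant_on_apply2:
  assumes "locally_constant_on X f" "locally_constant_on X g"
  shows "locally_constant_on X (\<lambda>x. k (f x) (g x))"
  unfolding locally_constant_on_def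
proof
  fix x assume x: "x \<in> topspace X"
  obtain U where U: "openin X U" "x \<in> U" "\<forall>y\<in>U. f y = f x"
    using assms(1) x unfolding locally_constant_on_def by blast
  obtain V where V: "openin X V" "x \<in> V" "\<forall>y\<in>V. g y = g x"
    using assms(2) x unfolding locally_constant_on_def by blast
  have "\<forall>y\<in>U \<inter> V. k (f y) (g y) = k (f x) (g x)"
    using U(3) V(3) by (metis IntE)
  then show "\<exists>U. openin X U \<and> x \<in> U \<and> (\<forall>y\<in>U. k (f y) (g y) = k (f x) (g x))"
    using openin_Int[OF U(1) V(1)] U(2) V(2) by blast
qed

lemma locally_constant_on_compose:
  assumes f: "locally_constant_on Y f" and s: "continuous_map X Y s"
  shows "locally_constant_on X (\<lambda>x. f (s x))"
  unfolding locally_constant_on_def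
proof
  fix x assume x: "x \<in> topspace X"
  then have "s x \<in> topspace Y"
    using s continuous_map_image_subset_topspace by fastforce
  then obtain U where U: "openin Y U" "s x \<in> U" "\<forall>y\<in>U. f y = f (s x)"
    using f unfolding locally_constant_on_def by blast
  have "openin X {x \<in> topspace X. s x \<in> U}"
    using openin_continuous_map_preimage[OF s U(1)] .
  then show "\<exists>U. openin X U \<and> x \<in> U \<and> (\<forall>y\<in>U. f (s y) = f (s x))"
    using x U(2,3) by (intro exI[of _ "{x \<in> topspace X. s x \<in> U}"]) blast
qed

lemma locally_constant_on_cong:
  assumes "\<And>x. x \<in> topspace X \<Longrightarrow> f x = g x" "locally_constant_on X f"
  shows "locally_constant_on X g"
  using assms unfolding locally_constant_on_def by (metis openin_subset subsetD)

text \<open>\<open>S\<close> is a variable of its own because the cochains are restricted to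
  \<open>carrier \<Gamma>\<close>, which equals the space of \<open>opens \<Gamma>\<close> only by
  an axiom of profinite groups.\<close>

lemma Maps_restrictI:
  assumes "S = topspace X" "\<And>x. x \<in> S \<Longrightarrow> f x \<in> carrier A" "locally_constant_on X f"
  shows "restrict f S \<in> Maps X A"
  using assms locally_constant_on_cong[of X f "restrict f S"] by (auto simp: Maps_iff)

lemma Maps_eqI:
  assumes "f \<in> Maps X A" "g \<in> Maps X B" "S = topspace X" "\<And>x. x \<in> S \<Longrightarrow> f x = g x"
  shows "f = g"
  using assms by (auto simp: Maps_iff intro: extensionalityI)

lemma Maps_locally_constant: "f \<in> Maps X A \<Longrightarrow> locally_constant_on X f"
  by (simp add: Maps_iff)

text \<open>The section \<open>s\<close> may be any function: composing a locally constant map with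
  it stays locally constant.\<close>

lemma Maps_lift:
  assumes s: "s ` A \<subseteq> carrier B" and eq: "\<forall>x\<in>A. r (s x) = x"
    and f: "f \<in> extensional (topspace X)" "f \<in> topspace X \<rightarrow> A" "locally_constant_on X f"
  obtains f' where "f' \<in> Maps X B" "(\<lambda>x\<in>topspace X. r (f' x)) = f"
proof (rule that)
  show "restrict (\<lambda>x. s (f x)) (topspace X) \<in> Maps X B"
    using s f locally_constant_on_apply[OF f(3), of s] by (intro Maps_restrictI) auto
  show "(\<lambda>x\<in>topspace X. r (restrict (\<lambda>x. s (f x)) (topspace X) x)) = f"
    using f(1) eq funcset_mem[OF f(2)] by (auto intro!: extensionalityI[of _ "topspace X"])
qed

text \<open>The case of \<open>Maps_lift\<close> where \<open>s\<close> chooses a preimage under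
  \<open>p\<close> of each element of the kernel of \<open>q\<close>.\<close>

lemma Maps_factor:
  assumes p: "p ` carrier A = kernel B C q" and f: "f \<in> Maps X B"
    and one: "\<And>x. x \<in> topspace X \<Longrightarrow> q (f x) = \<one>\<^bsub>C\<^esub>"
  obtains f' where "f' \<in> Maps X A" "(\<lambda>x\<in>topspace X. p (f' x)) = f"
proof -
  have "inv_into (carrier A) p ` kernel B C q \<subseteq> carrier A"
    "\<forall>x\<in>kernel B C q. p (inv_into (carrier A) p x) = x"
    unfolding p[symmetric] by (auto simp: inv_into_into f_inv_into_f)
  moreover have "f \<in> extensional (topspace X)" "f \<in> topspace X \<rightarrow> kernel B C q" "locally_constant_on X f"
    using f one by (auto simp: Maps_iff kernel_def)
  ultimately show ?thesis
    using that by (rule Maps_lift)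
qed

section \<open>Actions by automorphisms\<close>

text \<open>Composition and unit of \<open>AutoGroup A\<close> are functions restricted to the
  carrier of \<open>A\<close>, so the two equations can be read off only for \<open>x\<close> in
  that carrier.\<close>

lemma acts_by_autsD:
  assumes "acts_by_auts G A a" "group A" "group G"
  shows "g \<in> carrier G \<Longrightarrow> a g \<in> hom A A"
    and "g \<in> carrier G \<Longrightarrow> h \<in> carrier G \<Longrightarrow> x \<in> carrier A \<Longrightarrow> a (g \<otimes>\<^bsub>G\<^esub> h) x = a g (a h x)"
    and "x \<in> carrier A \<Longrightarrow> a \<one>\<^bsub>G\<^esub> x = x"
proof -
  interpret A: group A by fact
  interpret G: group G by fact
  have a: "a \<in> hom G (AutoGroup A)"
    using assms by (simp add: acts_by_auts_def)
  have au: "a g \<in> auto A" if "g \<in> carrier G" for g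
    using hom_in_carrier[OF a that] by (simp add: AutoGroup_def)
  show "a g \<in> hom A A" if "g \<in> carrier G"
    using au[OF that] by (simp add: auto_def)
  show "a (g \<otimes>\<^bsub>G\<^esub> h) x = a g (a h x)" if "g \<in> carrier G" "h \<in> carrier G" "x \<in> carrier A"
    using hom_mult[OF a that(1,2)] au that
    by (simp add: AutoGroup_def BijGroup_def auto_def compose_def)
  have "a \<one>\<^bsub>G\<^esub> = \<one>\<^bsub>AutoGroup A\<^esub>"
    using hom_one[OF a G.is_group A.AutoGroup] .
  then show "a \<one>\<^bsub>G\<^esub> x = x" if "x \<in> carrier A"
    using that by (simp add: AutoGroup_def BijGroup_def)
qed

section \<open>The cocycles of a crossed module\<close>

text \<open>In a right-nested product the factors \<open>inv x\<close> and \<open>x\<close> are not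
  adjacent as a subterm. These rules cancel them there and, with associativity and the inverse of a
  product, let the simplifier reduce group words.\<close>

lemma (in group) inv_mult_cancel:
  assumes "x \<in> carrier G" "y \<in> carrier G"
  shows "inv x \<otimes> (x \<otimes> y) = y" and "x \<otimes> (inv x \<otimes> y) = y"
  using assms by (simp_all flip: m_assoc)

lemma restrict_pair_cong:
  assumes "\<And>\<sigma> \<tau>. \<sigma> \<in> A \<Longrightarrow> \<tau> \<in> B \<Longrightarrow> f \<sigma> \<tau> = g \<sigma> \<tau>"
  shows "(\<lambda>(\<sigma>, \<tau>)\<in>A \<times> B. f \<sigma> \<tau>) = (\<lambda>(\<sigma>, \<tau>)\<in>A \<times> B. g \<sigma> \<tau>)"
  using assms by (auto intro!: restrict_ext)

lemma restrict_eq_iff: "restrict f A = restrict g A \<longleftrightarrow> (\<forall>x\<in>A. f x = g x)"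
  by (metis restrict_apply' restrict_ext)

text \<open>With \<open>x\<close>, \<open>y\<close>, \<open>z\<close> the values
  \<phi>(\<sigma>\<tau>), the \<sigma>-translate of \<phi>(\<tau>), and \<phi>(\<sigma>), the left
  side is the bracket in \<open>delta0_cochain\<close> set to one and the right side is the cocycle
  condition of \<open>Z0\<close>.\<close>

lemma (in group) mult_inv_eq_one_iff:
  "x \<in> carrier G \<Longrightarrow> y \<in> carrier G \<Longrightarrow> z \<in> carrier G \<Longrightarrow>
   x \<otimes> inv y \<otimes> inv z = \<one> \<longleftrightarrow> x = z \<otimes> y"
  by (metis inv_closed inv_mult_group inv_solve_right' l_one m_assoc m_closed one_closed)

lemma (in profinite_group) continuous_mult_of:
  assumes "continuous_map X (opens \<Gamma>) s" "continuous_map X (opens \<Gamma>) t"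
  shows "continuous_map X (opens \<Gamma>) (\<lambda>x. s x \<otimes> t x)"
proof -
  have "continuous_map X (prod_topology (opens \<Gamma>) (opens \<Gamma>)) (\<lambda>x. (s x, t x))"
    using assms by (simp add: continuous_map_pairedI)
  from continuous_map_compose[OF this continuous_mult] show ?thesis
    by (simp add: o_def)
qed

text \<open>Here the openness of stabilizers enters. The map \<open>s\<close> is general because the
  cochains need both the identity of \<Gamma> and the first projection of \<Gamma> \<times>
  \<Gamma>.\<close>

lemma (in profinite_group) locally_constant_on_action:
  assumes A: "is_Gamma_group \<Gamma> A ac" and s: "continuous_map X (opens \<Gamma>) s"
    and f: "locally_constant_on X f" "\<And>x. x \<in> topspace X \<Longrightarrow> f x \<in> carrier A"
  shows "locally_constant_on X (\<lambda>x. ac (s x) (f x))"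
  unfolding locally_constant_on_def
proof
  have grp: "group A" and act: "acts_by_auts \<Gamma> A ac"
    using A by (auto simp: is_Gamma_group_def)
  note ac = acts_by_autsD[OF act grp is_group]
  have s_closed: "s x \<in> carrier \<Gamma>" if "x \<in> topspace X" for x
    using s that continuous_map_funspace topspace_eq by fastforce
  fix x assume x: "x \<in> topspace X"
  obtain U where U: "openin X U" "x \<in> U" "\<forall>y\<in>U. f y = f x"
    using f(1) x unfolding locally_constant_on_def by blast
  \<comment> \<open>On \<open>V\<close> the element \<open>s y\<close> lies in the left coset of
    \<open>s x\<close> by the open stabilizer of \<open>f x\<close>, so \<open>s y\<close> and
    \<open>s x\<close> act on \<open>f x\<close> alike.\<close>
  define V where "V = {y \<in> topspace X. inv (s x) \<otimes> s y \<in> stabilizer \<Gamma> ac (f x)}"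
  have "continuous_map X (opens \<Gamma>) (\<lambda>y. inv (s x) \<otimes> s y)"
    using s s_closed[OF x] topspace_eq by (intro continuous_mult_of) auto
  then have V: "openin X V"
    unfolding V_def using A f(2)[OF x]
    by (intro openin_continuous_map_preimage) (auto simp: is_Gamma_group_def)
  have "x \<in> V"
    unfolding V_def stabilizer_def using x s_closed f(2) ac(3) by simp
  moreover have "ac (s y) (f y) = ac (s x) (f x)" if y: "y \<in> U \<inter> V" for y
  proof -
    have sy: "s y \<in> carrier \<Gamma>" "s x \<in> carrier \<Gamma>"
      using s_closed x y by (auto simp: V_def)
    have "ac (s y) (f x) = ac (s x \<otimes> (inv (s x) \<otimes> s y)) (f x)"
      using sy by (simp add: inv_mult_cancel)
    also have "\<dots> = ac (s x) (ac (inv (s x) \<otimes> s y) (f x))"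
      using sy f(2)[OF x] ac(2) by simp
    also have "ac (inv (s x) \<otimes> s y) (f x) = f x"
      using y by (simp add: V_def stabilizer_def)
    finally show ?thesis
      using U(3) y by simp
  qed
  ultimately show "\<exists>W. openin X W \<and> x \<in> W \<and> (\<forall>y\<in>W. ac (s y) (f y) = ac (s x) (f x))"
    using openin_Int[OF U(1) V] U(2) by blast
qed

section \<open>The axioms of a crossed module as rewrite rules\<close>

locale xmod_action = profinite_group \<Gamma>
  for \<Gamma> :: "'s top_group" (structure) +
  fixes M :: "('s, 'f, 'g) xmod"
  assumes xmod: "crossed_module_with_action \<Gamma> M"
begin

abbreviation "F \<equiv> FF M"
abbreviation "G \<equiv> GG M"

sublocale F: group F
  using xmod by (simp add: crossed_module_with_action_def crossed_module_def)

sublocale G: group G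
  using xmod by (simp add: crossed_module_with_action_def crossed_module_def)

sublocale bd: group_hom F G "bd M"
  using xmod F.is_group G.is_group
  by (simp add: crossed_module_with_action_def crossed_module_def group_hom_def group_hom_axioms_def)

lemma Gamma_groups: "is_Gamma_group \<Gamma> F (actF M)" "is_Gamma_group \<Gamma> G (actG M)"
  using xmod by (auto simp: crossed_module_with_action_def)

lemma auts: "acts_by_auts G F (act M)" "acts_by_auts \<Gamma> F (actF M)" "acts_by_auts \<Gamma> G (actG M)"
  using xmod by (auto simp: crossed_module_with_action_def crossed_module_def is_Gamma_group_def)

lemmas act_auts = acts_by_autsD[OF auts(1) F.is_group G.is_group]
lemmas actF_auts = acts_by_autsD[OF auts(2) F.is_group is_group]
lemmas actG_auts = acts_by_autsD[OF auts(3) G.is_group is_group]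

lemma act_group_hom: "g \<in> carrier G \<Longrightarrow> group_hom F F (act M g)"
  by (simp add: group_hom_def group_hom_axioms_def F.is_group act_auts(1))

lemma actF_group_hom: "\<sigma> \<in> carrier \<Gamma> \<Longrightarrow> group_hom F F (actF M \<sigma>)"
  by (simp add: group_hom_def group_hom_axioms_def F.is_group actF_auts(1))

lemma actG_group_hom: "\<sigma> \<in> carrier \<Gamma> \<Longrightarrow> group_hom G G (actG M \<sigma>)"
  by (simp add: group_hom_def group_hom_axioms_def G.is_group actG_auts(1))

text \<open>With the crossed module rules below, these push every action inwards to single letters
  and turn the action of a boundary into conjugation. Cocycle identities then become equalities of
  group words, which \<open>group_simps\<close> normalizes.\<close>

lemmas action_simps [simp] =
  group_hom.hom_closed[OF act_group_hom] group_hom.hom_mult[OF act_group_hom]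
  group_hom.hom_one[OF act_group_hom] group_hom.hom_inv[OF act_group_hom]
  group_hom.hom_closed[OF actF_group_hom] group_hom.hom_mult[OF actF_group_hom]
  group_hom.hom_one[OF actF_group_hom] group_hom.hom_inv[OF actF_group_hom]
  group_hom.hom_closed[OF actG_group_hom] group_hom.hom_mult[OF actG_group_hom]
  group_hom.hom_one[OF actG_group_hom] group_hom.hom_inv[OF actG_group_hom]
  act_auts(2,3) actF_auts(2,3) actG_auts(2,3)

lemma act_bd [simp]:
  "f \<in> carrier F \<Longrightarrow> f' \<in> carrier F \<Longrightarrow> act M (bd M f) f' = f \<otimes>\<^bsub>F\<^esub> f' \<otimes>\<^bsub>F\<^esub> inv\<^bsub>F\<^esub> f"
  using xmod by (simp add: crossed_module_with_action_def crossed_module_def)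

lemma act_inv_bd [simp]:
  "f \<in> carrier F \<Longrightarrow> f' \<in> carrier F \<Longrightarrow>
   act M (inv\<^bsub>G\<^esub> (bd M f)) f' = inv\<^bsub>F\<^esub> f \<otimes>\<^bsub>F\<^esub> f' \<otimes>\<^bsub>F\<^esub> f"
  using act_bd[of "inv\<^bsub>F\<^esub> f" f'] by (simp del: act_bd)

lemma bd_act [simp]:
  "g \<in> carrier G \<Longrightarrow> f \<in> carrier F \<Longrightarrow>
   bd M (act M g f) = g \<otimes>\<^bsub>G\<^esub> bd M f \<otimes>\<^bsub>G\<^esub> inv\<^bsub>G\<^esub> g"
  using xmod by (simp add: crossed_module_with_action_def crossed_module_def)

lemma bd_actF [simp]:
  "\<sigma> \<in> carrier \<Gamma> \<Longrightarrow> f \<in> carrier F \<Longrightarrow> bd M (actF M \<sigma> f) = actG M \<sigma> (bd M f)"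
  using xmod by (simp add: crossed_module_with_action_def)

lemma actF_act [simp]:
  "\<sigma> \<in> carrier \<Gamma> \<Longrightarrow> g \<in> carrier G \<Longrightarrow> f \<in> carrier F \<Longrightarrow>
   actF M \<sigma> (act M g f) = act M (actG M \<sigma> g) (actF M \<sigma> f)"
  using xmod by (simp add: crossed_module_with_action_def)

text \<open>The simplifier splits the action of a product into successive actions, so a letter and
  its inverse in the acting group have to cancel in this split form.\<close>

lemma act_inv_cancel [simp]:
  assumes "g \<in> carrier G" "f \<in> carrier F"
  shows "act M g (act M (inv\<^bsub>G\<^esub> g) f) = f" "act M (inv\<^bsub>G\<^esub> g) (act M g f) = f"
  using act_auts(2)[of g "inv\<^bsub>G\<^esub> g" f] act_auts(2)[of "inv\<^bsub>G\<^esub> g" g f] assms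
  by (simp_all del: act_auts(2))

lemmas group_simps = F.m_assoc G.m_assoc F.inv_mult_group G.inv_mult_group
  F.inv_mult_cancel G.inv_mult_cancel

section \<open>Cochains and the group \<open>C0\<close>\<close>

abbreviation "MapsF \<equiv> Maps (opens \<Gamma>) F"
abbreviation "MapsG \<equiv> Maps (opens \<Gamma>) G"
abbreviation "Maps2F \<equiv> Maps (prod_topology (opens \<Gamma>) (opens \<Gamma>)) F"

lemma Maps_closed [simp]:
  "\<phi> \<in> Maps (opens \<Gamma>) A \<Longrightarrow> \<sigma> \<in> carrier \<Gamma> \<Longrightarrow> \<phi> \<sigma> \<in> carrier A"
  "h \<in> Maps (prod_topology (opens \<Gamma>) (opens \<Gamma>)) A \<Longrightarrow> \<sigma> \<in> carrier \<Gamma> \<Longrightarrow> \<tau> \<in> carrier \<Gamma> \<Longrightarrow>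
     h (\<sigma>, \<tau>) \<in> carrier A"
  by (auto simp: Maps_iff topspace_eq)

lemma Maps_restrict [simp]:
  "\<phi> \<in> Maps (opens \<Gamma>) A \<Longrightarrow> restrict \<phi> (carrier \<Gamma>) = \<phi>"
  "h \<in> Maps (prod_topology (opens \<Gamma>) (opens \<Gamma>)) A \<Longrightarrow> restrict h (carrier \<Gamma> \<times> carrier \<Gamma>) = h"
  by (simp_all add: Maps_iff topspace_eq extensional_restrict)

lemma C0_carrier: "carrier (C0 \<Gamma> M) = MapsF \<times> carrier G"
  by (simp add: C0_def)

lemma C0_mult:
  "(\<phi>1, g1) \<otimes>\<^bsub>C0 \<Gamma> M\<^esub> (\<phi>2, g2) =
     (\<lambda>\<sigma>\<in>carrier \<Gamma>. act M g1 (\<phi>2 \<sigma>) \<otimes>\<^bsub>F\<^esub> \<phi>1 \<sigma>, g1 \<otimes>\<^bsub>G\<^esub> g2)"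
  by (simp add: C0_def)

lemma C0_one: "\<one>\<^bsub>C0 \<Gamma> M\<^esub> = (\<lambda>\<sigma>\<in>carrier \<Gamma>. \<one>\<^bsub>F\<^esub>, \<one>\<^bsub>G\<^esub>)"
  by (simp add: C0_def)

lemma MapsF_one: "(\<lambda>\<sigma>\<in>carrier \<Gamma>. \<one>\<^bsub>F\<^esub>) \<in> MapsF"
  by (intro Maps_restrictI) (auto simp: topspace_eq locally_constant_on_const)

lemma MapsF_mult:
  assumes "g \<in> carrier G" "\<phi> \<in> MapsF" "\<psi> \<in> MapsF"
  shows "(\<lambda>\<sigma>\<in>carrier \<Gamma>. act M g (\<phi> \<sigma>) \<otimes>\<^bsub>F\<^esub> \<psi> \<sigma>) \<in> MapsF"
  using assms
    locally_constant_on_apply2[of _ \<phi> \<psi> "\<lambda>x y. act M g x \<otimes>\<^bsub>F\<^esub> y", OF Maps_locally_constant Maps_locally_constant]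
  by (intro Maps_restrictI) (auto simp: topspace_eq)

lemma MapsF_inv:
  assumes "g \<in> carrier G" "\<phi> \<in> MapsF"
  shows "(\<lambda>\<sigma>\<in>carrier \<Gamma>. act M g (inv\<^bsub>F\<^esub> (\<phi> \<sigma>))) \<in> MapsF"
  using assms locally_constant_on_apply[of _ \<phi> "\<lambda>x. act M g (inv\<^bsub>F\<^esub> x)", OF Maps_locally_constant]
  by (intro Maps_restrictI) (auto simp: topspace_eq)

text \<open>This is the semidirect product of \<open>G\<close> with the opposite of the group of
  continuous maps from \<Gamma> to \<open>F\<close>, on which \<open>G\<close> acts
  valuewise.\<close>

lemma C0_group: "group (C0 \<Gamma> M)"
proof (rule groupI)
  show "\<one>\<^bsub>C0 \<Gamma> M\<^esub> \<in> carrier (C0 \<Gamma> M)"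
    by (simp add: C0_carrier C0_one MapsF_one)
next
  fix x assume "x \<in> carrier (C0 \<Gamma> M)"
  then obtain \<phi> g where x: "x = (\<phi>, g)" "\<phi> \<in> MapsF" "g \<in> carrier G"
    by (auto simp: C0_carrier)
  show "\<one>\<^bsub>C0 \<Gamma> M\<^esub> \<otimes>\<^bsub>C0 \<Gamma> M\<^esub> x = x"
    using x by (simp add: C0_one C0_mult cong: restrict_cong)
  \<comment> \<open>\<open>groupI\<close> asks for a left inverse. Its second component must be the
    inverse of \<open>g\<close>, which applied to \<phi> has to cancel against the first
    component.\<close>
  have "(\<lambda>\<sigma>\<in>carrier \<Gamma>. act M (inv\<^bsub>G\<^esub> g) (inv\<^bsub>F\<^esub> (\<phi> \<sigma>)), inv\<^bsub>G\<^esub> g) \<otimes>\<^bsub>C0 \<Gamma> M\<^esub> x = \<one>\<^bsub>C0 \<Gamma> M\<^esub>"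
    using x by (simp add: C0_one C0_mult cong: restrict_cong)
  then show "\<exists>y\<in>carrier (C0 \<Gamma> M). y \<otimes>\<^bsub>C0 \<Gamma> M\<^esub> x = \<one>\<^bsub>C0 \<Gamma> M\<^esub>"
    using x MapsF_inv by (intro bexI) (auto simp: C0_carrier)
next
  fix x y assume "x \<in> carrier (C0 \<Gamma> M)" "y \<in> carrier (C0 \<Gamma> M)"
  then show "x \<otimes>\<^bsub>C0 \<Gamma> M\<^esub> y \<in> carrier (C0 \<Gamma> M)"
    by (auto simp: C0_carrier C0_mult MapsF_mult)
next
  fix x y z
  assume "x \<in> carrier (C0 \<Gamma> M)" "y \<in> carrier (C0 \<Gamma> M)" "z \<in> carrier (C0 \<Gamma> M)"
  then show "x \<otimes>\<^bsub>C0 \<Gamma> M\<^esub> y \<otimes>\<^bsub>C0 \<Gamma> M\<^esub> z = x \<otimes>\<^bsub>C0 \<Gamma> M\<^esub> (y \<otimes>\<^bsub>C0 \<Gamma> M\<^esub> z)"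
    by (auto simp: C0_carrier C0_mult group_simps cong: restrict_cong)
qed

sublocale C0: group "C0 \<Gamma> M"
  by (rule C0_group)

section \<open>The action of \<open>F\<close> on \<open>Z0\<close>\<close>

lemma F_act_Z0_eq:
  "F_act_Z0 \<Gamma> M (\<phi>, g) f =
     (\<lambda>\<sigma>\<in>carrier \<Gamma>. inv\<^bsub>F\<^esub> f \<otimes>\<^bsub>F\<^esub> \<phi> \<sigma> \<otimes>\<^bsub>F\<^esub> actF M \<sigma> f, inv\<^bsub>G\<^esub> (bd M f) \<otimes>\<^bsub>G\<^esub> g)"
  by (simp add: F_act_Z0_def)

text \<open>Stated on all of \<open>C0\<close>: a cocycle of the third crossed module lifts only to
  a cochain of the middle one, and \<open>F\<close> has to act on that lift when the representative
  changes.\<close>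

lemma F_act_closed:
  assumes "z \<in> carrier (C0 \<Gamma> M)" "f \<in> carrier F"
  shows "F_act_Z0 \<Gamma> M z f \<in> carrier (C0 \<Gamma> M)"
proof -
  obtain \<phi> g where z: "z = (\<phi>, g)" "\<phi> \<in> MapsF" "g \<in> carrier G"
    using assms by (auto simp: C0_carrier)
  have "locally_constant_on (opens \<Gamma>) (\<lambda>\<sigma>. actF M \<sigma> f)"
    using assms(2) by (intro locally_constant_on_action[OF Gamma_groups(1)] locally_constant_on_const) auto
  then have "locally_constant_on (opens \<Gamma>) (\<lambda>\<sigma>. inv\<^bsub>F\<^esub> f \<otimes>\<^bsub>F\<^esub> \<phi> \<sigma> \<otimes>\<^bsub>F\<^esub> actF M \<sigma> f)"
    using locally_constant_on_apply2[of _ \<phi> "\<lambda>\<sigma>. actF M \<sigma> f" "\<lambda>x y. inv\<^bsub>F\<^esub> f \<otimes>\<^bsub>F\<^esub> x \<otimes>\<^bsub>F\<^esub> y"]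
      Maps_locally_constant[OF z(2)] by simp
  then show ?thesis
    using z assms(2) by (auto simp: F_act_Z0_eq C0_carrier topspace_eq intro!: Maps_restrictI)
qed

text \<open>The first component of the product applies the inverse of \<open>bd M f\<close> to the
  value of \<open>z\<close>. By the Peiffer identity this is conjugation by the inverse of
  \<open>f\<close>, and its trailing \<open>f\<close> cancels the leading inverse of
  \<open>f\<close> in the coboundary.\<close>

lemma F_act_Z0_one_mult:
  assumes "z \<in> carrier (C0 \<Gamma> M)" "f \<in> carrier F"
  shows "F_act_Z0 \<Gamma> M z f = F_act_Z0 \<Gamma> M \<one>\<^bsub>C0 \<Gamma> M\<^esub> f \<otimes>\<^bsub>C0 \<Gamma> M\<^esub> z"
  using assms
  by (auto simp: C0_carrier C0_one F_act_Z0_eq C0_mult group_simps cong: restrict_cong)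

lemma Z0_iff:
  "(\<phi>, g) \<in> Z0 \<Gamma> M \<longleftrightarrow> \<phi> \<in> MapsF \<and> g \<in> carrier G \<and>
     (\<forall>\<sigma>\<in>carrier \<Gamma>. \<forall>\<tau>\<in>carrier \<Gamma>. \<phi> (\<sigma> \<otimes> \<tau>) = \<phi> \<sigma> \<otimes>\<^bsub>F\<^esub> actF M \<sigma> (\<phi> \<tau>)) \<and>
     (\<forall>\<sigma>\<in>carrier \<Gamma>. actG M \<sigma> g = inv\<^bsub>G\<^esub> (bd M (\<phi> \<sigma>)) \<otimes>\<^bsub>G\<^esub> g)"
  by (auto simp: Z0_def C0_carrier)

lemma Z0_subset_C0: "Z0 \<Gamma> M \<subseteq> carrier (C0 \<Gamma> M)"
  by (auto simp: Z0_iff C0_carrier)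

sublocale Z0: right_action F "Z0 \<Gamma> M" "F_act_Z0 \<Gamma> M"
proof
  fix z f assume z: "z \<in> Z0 \<Gamma> M" and f: "f \<in> carrier F"
  have "F_act_Z0 \<Gamma> M z f \<in> carrier (C0 \<Gamma> M)"
    using F_act_closed z f Z0_subset_C0 by blast
  then show "F_act_Z0 \<Gamma> M z f \<in> Z0 \<Gamma> M"
    using z f by (cases z) (auto simp: Z0_iff F_act_Z0_eq C0_carrier group_simps)
next
  fix z assume "z \<in> Z0 \<Gamma> M"
  then show "F_act_Z0 \<Gamma> M z \<one>\<^bsub>F\<^esub> = z"
    by (cases z) (auto simp: Z0_iff F_act_Z0_eq cong: restrict_cong)
next
  fix z f f' assume "z \<in> Z0 \<Gamma> M" "f \<in> carrier F" "f' \<in> carrier F"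
  then show "F_act_Z0 \<Gamma> M z (f \<otimes>\<^bsub>F\<^esub> f') = F_act_Z0 \<Gamma> M (F_act_Z0 \<Gamma> M z f) f'"
    by (cases z) (auto simp: Z0_iff F_act_Z0_eq group_simps cong: restrict_cong)
qed

section \<open>The action of \<open>C0\<close> on \<open>Z1\<close>\<close>

lemma C0_act_Z1_eq:
  "C0_act_Z1 \<Gamma> M (h, \<psi>) (a, g) =
     (\<lambda>(\<sigma>, \<tau>)\<in>carrier \<Gamma> \<times> carrier \<Gamma>.
        act M (inv\<^bsub>G\<^esub> g)
          (a (\<sigma> \<otimes> \<tau>) \<otimes>\<^bsub>F\<^esub> h (\<sigma>, \<tau>)
             \<otimes>\<^bsub>F\<^esub> act M (\<psi> \<sigma>) (actF M \<sigma> (inv\<^bsub>F\<^esub> (a \<tau>))) \<otimes>\<^bsub>F\<^esub> inv\<^bsub>F\<^esub> (a \<sigma>)),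
      \<lambda>\<sigma>\<in>carrier \<Gamma>. inv\<^bsub>G\<^esub> g \<otimes>\<^bsub>G\<^esub> bd M (a \<sigma>) \<otimes>\<^bsub>G\<^esub> \<psi> \<sigma> \<otimes>\<^bsub>G\<^esub> actG M \<sigma> g)"
  by (simp add: C0_act_Z1_def)

lemma Z1_iff:
  "(h, \<psi>) \<in> Z1 \<Gamma> M \<longleftrightarrow> h \<in> Maps2F \<and> \<psi> \<in> MapsG \<and>
     (\<forall>\<sigma>\<in>carrier \<Gamma>. \<forall>\<tau>\<in>carrier \<Gamma>.
        \<psi> \<sigma> \<otimes>\<^bsub>G\<^esub> actG M \<sigma> (\<psi> \<tau>) = inv\<^bsub>G\<^esub> (bd M (h (\<sigma>, \<tau>))) \<otimes>\<^bsub>G\<^esub> \<psi> (\<sigma> \<otimes> \<tau>)) \<and>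
     (\<forall>\<sigma>\<in>carrier \<Gamma>. \<forall>\<tau>\<in>carrier \<Gamma>. \<forall>\<upsilon>\<in>carrier \<Gamma>.
        h (\<sigma>, \<tau> \<otimes> \<upsilon>) \<otimes>\<^bsub>F\<^esub> act M (\<psi> \<sigma>) (actF M \<sigma> (h (\<tau>, \<upsilon>)))
          = h (\<sigma> \<otimes> \<tau>, \<upsilon>) \<otimes>\<^bsub>F\<^esub> h (\<sigma>, \<tau>))"
  by (simp add: Z1_def)

text \<open>Each component is built from functions of two locally constant arguments, so its
  products are bracketed differently from \<open>C0_act_Z1_eq\<close>; associativity identifies the
  two forms at the end.\<close>

lemma C0_act_Z1_Maps:
  assumes h: "h \<in> Maps2F" and \<psi>: "\<psi> \<in> MapsG" and a: "a \<in> MapsF" and g: "g \<in> carrier G"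
  shows "C0_act_Z1 \<Gamma> M (h, \<psi>) (a, g) \<in> Maps2F \<times> MapsG"
proof -
  let ?P = "prod_topology (opens \<Gamma>) (opens \<Gamma>)"
  have fst: "continuous_map ?P (opens \<Gamma>) fst" and snd: "continuous_map ?P (opens \<Gamma>) snd"
    by (simp_all add: continuous_map_fst continuous_map_snd)
  note [simp] = topspace_eq
  have "locally_constant_on (opens \<Gamma>) (\<lambda>\<sigma>. actG M \<sigma> g)"
    using g by (intro locally_constant_on_action[OF Gamma_groups(2)] locally_constant_on_const) auto
  then have "locally_constant_on (opens \<Gamma>) (\<lambda>\<sigma>. \<psi> \<sigma> \<otimes>\<^bsub>G\<^esub> actG M \<sigma> g)"
    using locally_constant_on_apply2[OF Maps_locally_constant[OF \<psi>]] by blast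
  from locally_constant_on_apply2[OF Maps_locally_constant[OF a] this,
      of "\<lambda>x y. inv\<^bsub>G\<^esub> g \<otimes>\<^bsub>G\<^esub> bd M x \<otimes>\<^bsub>G\<^esub> y"]
  have 1: "(\<lambda>\<sigma>\<in>carrier \<Gamma>. inv\<^bsub>G\<^esub> g \<otimes>\<^bsub>G\<^esub> bd M (a \<sigma>) \<otimes>\<^bsub>G\<^esub> (\<psi> \<sigma> \<otimes>\<^bsub>G\<^esub> actG M \<sigma> g)) \<in> MapsG"
    using a g \<psi> by (intro Maps_restrictI) auto
  have a1: "locally_constant_on ?P (\<lambda>x. a (fst x))" and a2: "locally_constant_on ?P (\<lambda>x. a (snd x))"
    and a3: "locally_constant_on ?P (\<lambda>x. a (fst x \<otimes> snd x))"
    and p1: "locally_constant_on ?P (\<lambda>x. \<psi> (fst x))"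
    using locally_constant_on_compose[OF Maps_locally_constant] a \<psi> fst snd continuous_mult_of[OF fst snd]
    by fast+
  have "locally_constant_on ?P (\<lambda>x. inv\<^bsub>F\<^esub> (a (snd x)))"
    using locally_constant_on_apply[OF a2] by blast
  then have "locally_constant_on ?P (\<lambda>x. actF M (fst x) (inv\<^bsub>F\<^esub> (a (snd x))))"
    using a by (intro locally_constant_on_action[OF Gamma_groups(1) fst]) auto
  from locally_constant_on_apply2[OF p1 this, of "act M"]
  have "locally_constant_on ?P (\<lambda>x. act M (\<psi> (fst x)) (actF M (fst x) (inv\<^bsub>F\<^esub> (a (snd x)))))" .
  from locally_constant_on_apply2[OF this a1, of "\<lambda>x y. x \<otimes>\<^bsub>F\<^esub> inv\<^bsub>F\<^esub> y"]
  have r: "locally_constant_on ?P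
      (\<lambda>x. act M (\<psi> (fst x)) (actF M (fst x) (inv\<^bsub>F\<^esub> (a (snd x)))) \<otimes>\<^bsub>F\<^esub> inv\<^bsub>F\<^esub> (a (fst x)))" .
  from locally_constant_on_apply2[OF a3 Maps_locally_constant[OF h], of "(\<otimes>\<^bsub>F\<^esub>)"]
  have l: "locally_constant_on ?P (\<lambda>x. a (fst x \<otimes> snd x) \<otimes>\<^bsub>F\<^esub> h x)" .
  from locally_constant_on_apply2[OF l r, of "\<lambda>x y. act M (inv\<^bsub>G\<^esub> g) (x \<otimes>\<^bsub>F\<^esub> y)"]
  have 2: "(\<lambda>x\<in>carrier \<Gamma> \<times> carrier \<Gamma>. act M (inv\<^bsub>G\<^esub> g) ((a (fst x \<otimes> snd x) \<otimes>\<^bsub>F\<^esub> h x) \<otimes>\<^bsub>F\<^esub>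
      (act M (\<psi> (fst x)) (actF M (fst x) (inv\<^bsub>F\<^esub> (a (snd x)))) \<otimes>\<^bsub>F\<^esub> inv\<^bsub>F\<^esub> (a (fst x))))) \<in> Maps2F"
    using a g h \<psi> by (intro Maps_restrictI) auto
  have "fst (C0_act_Z1 \<Gamma> M (h, \<psi>) (a, g)) =
    (\<lambda>x\<in>carrier \<Gamma> \<times> carrier \<Gamma>. act M (inv\<^bsub>G\<^esub> g) ((a (fst x \<otimes> snd x) \<otimes>\<^bsub>F\<^esub> h x) \<otimes>\<^bsub>F\<^esub>
      (act M (\<psi> (fst x)) (actF M (fst x) (inv\<^bsub>F\<^esub> (a (snd x)))) \<otimes>\<^bsub>F\<^esub> inv\<^bsub>F\<^esub> (a (fst x)))))"
    using h a \<psi> g unfolding C0_act_Z1_eq by (auto simp: F.m_assoc intro!: restrict_ext)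
  moreover have "snd (C0_act_Z1 \<Gamma> M (h, \<psi>) (a, g)) =
    (\<lambda>\<sigma>\<in>carrier \<Gamma>. inv\<^bsub>G\<^esub> g \<otimes>\<^bsub>G\<^esub> bd M (a \<sigma>) \<otimes>\<^bsub>G\<^esub> (\<psi> \<sigma> \<otimes>\<^bsub>G\<^esub> actG M \<sigma> g))"
    using a \<psi> g unfolding C0_act_Z1_eq by (auto simp: G.m_assoc intro!: restrict_ext)
  ultimately show ?thesis
    using 1 2 by (simp add: mem_Times_iff)
qed

lemma C0_act_Z1_closed:
  assumes z: "(h, \<psi>) \<in> Z1 \<Gamma> M" and a: "a \<in> MapsF" and g: "g \<in> carrier G"
  shows "C0_act_Z1 \<Gamma> M (h, \<psi>) (a, g) \<in> Z1 \<Gamma> M"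
proof -
  have [simp]: "h \<in> Maps2F" "\<psi> \<in> MapsG" "a \<in> MapsF" "g \<in> carrier G"
    using z a g by (simp_all add: Z1_iff)
  \<comment> \<open>Both cocycle conditions are solved for the term carrying the action of \<sigma>.
    As rewrite rules they eliminate these terms, and the conditions for the new pair reduce to equal
    group words.\<close>
  have \<psi>: "actG M \<sigma> (\<psi> \<tau>) = inv\<^bsub>G\<^esub> (\<psi> \<sigma>) \<otimes>\<^bsub>G\<^esub> (inv\<^bsub>G\<^esub> (bd M (h (\<sigma>, \<tau>))) \<otimes>\<^bsub>G\<^esub> \<psi> (\<sigma> \<otimes> \<tau>))"
    if "\<sigma> \<in> carrier \<Gamma>" "\<tau> \<in> carrier \<Gamma>" for \<sigma> \<tau>
  proof -
    have "\<psi> \<sigma> \<otimes>\<^bsub>G\<^esub> actG M \<sigma> (\<psi> \<tau>) = inv\<^bsub>G\<^esub> (bd M (h (\<sigma>, \<tau>))) \<otimes>\<^bsub>G\<^esub> \<psi> (\<sigma> \<otimes> \<tau>)"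
      using z that by (simp add: Z1_iff)
    then show ?thesis
      using that by (simp add: G.inv_solve_left G.inv_mult_cancel)
  qed
  have h: "act M (\<psi> \<sigma>) (actF M \<sigma> (h (\<tau>, \<upsilon>))) =
      inv\<^bsub>F\<^esub> (h (\<sigma>, \<tau> \<otimes> \<upsilon>)) \<otimes>\<^bsub>F\<^esub> (h (\<sigma> \<otimes> \<tau>, \<upsilon>) \<otimes>\<^bsub>F\<^esub> h (\<sigma>, \<tau>))"
    if "\<sigma> \<in> carrier \<Gamma>" "\<tau> \<in> carrier \<Gamma>" "\<upsilon> \<in> carrier \<Gamma>" for \<sigma> \<tau> \<upsilon>
  proof -
    have "h (\<sigma>, \<tau> \<otimes> \<upsilon>) \<otimes>\<^bsub>F\<^esub> act M (\<psi> \<sigma>) (actF M \<sigma> (h (\<tau>, \<upsilon>))) =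
        h (\<sigma> \<otimes> \<tau>, \<upsilon>) \<otimes>\<^bsub>F\<^esub> h (\<sigma>, \<tau>)"
      using z that by (simp add: Z1_iff)
    then show ?thesis
      using that by (simp add: F.inv_solve_left F.inv_mult_cancel)
  qed
  show ?thesis
    using C0_act_Z1_Maps[of h \<psi> a g]
    unfolding C0_act_Z1_eq Z1_iff by (simp add: group_simps m_assoc \<psi> h)
qed

text \<open>This explains the product of \<open>C0\<close>: moving the inverse of \<open>g\<close>
  to the left past the boundary of \<open>a' \<sigma>\<close> replaces \<open>a' \<sigma>\<close> by
  \<open>act M g (a' \<sigma>)\<close>, which stands to the left of
  \<open>a \<sigma>\<close>.\<close>

lemma C0_act_Z1_mult:
  assumes "(h, \<psi>) \<in> Z1 \<Gamma> M" "a \<in> MapsF" "g \<in> carrier G" "a' \<in> MapsF" "g' \<in> carrier G"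
  shows "C0_act_Z1 \<Gamma> M (h, \<psi>) ((a, g) \<otimes>\<^bsub>C0 \<Gamma> M\<^esub> (a', g')) =
    C0_act_Z1 \<Gamma> M (C0_act_Z1 \<Gamma> M (h, \<psi>) (a, g)) (a', g')"
proof -
  have [simp]: "h \<in> Maps2F" "\<psi> \<in> MapsG"
    using assms by (simp_all add: Z1_iff)
  show ?thesis
    using assms(2-)
    by (auto simp: C0_act_Z1_eq C0_mult group_simps intro!: restrict_pair_cong restrict_ext)
qed

sublocale Z1: right_action "C0 \<Gamma> M" "Z1 \<Gamma> M" "C0_act_Z1 \<Gamma> M"
proof
  fix z c assume "z \<in> Z1 \<Gamma> M" "c \<in> carrier (C0 \<Gamma> M)"
  then show "C0_act_Z1 \<Gamma> M z c \<in> Z1 \<Gamma> M"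
    using C0_act_Z1_closed by (cases z, cases c) (auto simp: C0_carrier)
next
  fix z assume z: "z \<in> Z1 \<Gamma> M"
  obtain h \<psi> where h: "z = (h, \<psi>)" "h \<in> Maps2F" "\<psi> \<in> MapsG"
    using z by (cases z) (auto simp: Z1_iff)
  have "C0_act_Z1 \<Gamma> M z \<one>\<^bsub>C0 \<Gamma> M\<^esub> =
      (\<lambda>(\<sigma>, \<tau>)\<in>carrier \<Gamma> \<times> carrier \<Gamma>. h (\<sigma>, \<tau>), \<lambda>\<sigma>\<in>carrier \<Gamma>. \<psi> \<sigma>)"
    unfolding h(1) C0_one C0_act_Z1_eq using h(2,3)
    by (intro arg_cong2[where f = Pair] restrict_pair_cong restrict_ext) simp_all
  then show "C0_act_Z1 \<Gamma> M z \<one>\<^bsub>C0 \<Gamma> M\<^esub> = z"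
    using h by simp
next
  fix z c c'
  assume "z \<in> Z1 \<Gamma> M" "c \<in> carrier (C0 \<Gamma> M)" "c' \<in> carrier (C0 \<Gamma> M)"
  then show "C0_act_Z1 \<Gamma> M z (c \<otimes>\<^bsub>C0 \<Gamma> M\<^esub> c') = C0_act_Z1 \<Gamma> M (C0_act_Z1 \<Gamma> M z c) c'"
    using C0_act_Z1_mult by (cases z, cases c, cases c') (auto simp: C0_carrier)
qed

section \<open>Base points, their stabilizers and the connecting cochains\<close>

lemma one_in_Z0: "\<one>\<^bsub>C0 \<Gamma> M\<^esub> \<in> Z0 \<Gamma> M"
  by (simp add: C0_one Z0_iff MapsF_one)

lemma one1_in_Z1: "one1 \<Gamma> M \<in> Z1 \<Gamma> M"
proof -
  have "(\<lambda>x\<in>carrier \<Gamma> \<times> carrier \<Gamma>. \<one>\<^bsub>F\<^esub>) \<in> Maps2F" "(\<lambda>\<sigma>\<in>carrier \<Gamma>. \<one>\<^bsub>G\<^esub>) \<in> MapsG"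
    by (auto intro!: Maps_restrictI simp: topspace_eq locally_constant_on_const)
  then show ?thesis
    by (simp add: one1_def Z1_iff)
qed

lemma Cl0_eq: "Cl0 \<Gamma> M = Z0.orb"
  by (simp add: Cl0_def Z0.orb_def fun_eq_iff)

lemma Cl1_eq: "Cl1 \<Gamma> M = Z1.orb"
  by (simp add: Cl1_def Z1.orb_def fun_eq_iff)

lemma stab_one: "Z0.stab \<one>\<^bsub>C0 \<Gamma> M\<^esub> = carrier (Hm1 \<Gamma> M)"
proof -
  have "F_act_Z0 \<Gamma> M \<one>\<^bsub>C0 \<Gamma> M\<^esub> f = \<one>\<^bsub>C0 \<Gamma> M\<^esub> \<longleftrightarrow>
      bd M f = \<one>\<^bsub>G\<^esub> \<and> (\<forall>\<sigma>\<in>carrier \<Gamma>. actF M \<sigma> f = f)"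
    if "f \<in> carrier F" for f
    using that by (auto simp: C0_one F_act_Z0_eq restrict_eq_iff F.inv_solve_left')
  then show ?thesis
    by (auto simp: Z0.stab_def Hm1_def kernel_def)
qed

lemma delta0_cochain_eq:
  assumes "c \<in> carrier (C0 \<Gamma> M)"
  shows "delta0_cochain \<Gamma> M c = C0_act_Z1 \<Gamma> M (one1 \<Gamma> M) c"
  using assms
  by (cases c) (auto simp: delta0_cochain_def one1_def C0_act_Z1_eq C0_carrier
      intro!: restrict_pair_cong restrict_ext)

lemma deltam1_cochain_eq:
  assumes "f \<in> carrier F"
  shows "deltam1_cochain \<Gamma> M f = F_act_Z0 \<Gamma> M \<one>\<^bsub>C0 \<Gamma> M\<^esub> (inv\<^bsub>F\<^esub> f)"
  using assms by (auto simp: deltam1_cochain_def C0_one F_act_Z0_eq intro!: restrict_ext)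

lemma stab_one1: "Z1.stab (one1 \<Gamma> M) = Z0 \<Gamma> M"
proof -
  have "C0_act_Z1 \<Gamma> M (one1 \<Gamma> M) (\<phi>, g) = one1 \<Gamma> M \<longleftrightarrow> (\<phi>, g) \<in> Z0 \<Gamma> M"
    if \<phi>: "\<phi> \<in> MapsF" and g: "g \<in> carrier G" for \<phi> g
  proof -
    \<comment> \<open>This strips the outer action from the bracket of the cochain. Below,
      \<open>action_simps(2)\<close> is switched off, since distributing the action over the bracket
      would hide the pattern.\<close>
    have act_one_iff: "act M (inv\<^bsub>G\<^esub> g) x = \<one>\<^bsub>F\<^esub> \<longleftrightarrow> x = \<one>\<^bsub>F\<^esub>" if "x \<in> carrier F" for x
      using act_inv_cancel(1)[OF g that] g by auto
    have "C0_act_Z1 \<Gamma> M (one1 \<Gamma> M) (\<phi>, g) = delta0_cochain \<Gamma> M (\<phi>, g)"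
      using \<phi> g by (simp add: delta0_cochain_eq C0_carrier)
    also have "\<dots> = one1 \<Gamma> M \<longleftrightarrow>
      (\<forall>\<sigma>\<in>carrier \<Gamma>. \<forall>\<tau>\<in>carrier \<Gamma>.
        \<phi> (\<sigma> \<otimes> \<tau>) \<otimes>\<^bsub>F\<^esub> inv\<^bsub>F\<^esub> (actF M \<sigma> (\<phi> \<tau>)) \<otimes>\<^bsub>F\<^esub> inv\<^bsub>F\<^esub> (\<phi> \<sigma>) = \<one>\<^bsub>F\<^esub>) \<and>
      (\<forall>\<sigma>\<in>carrier \<Gamma>. inv\<^bsub>G\<^esub> g \<otimes>\<^bsub>G\<^esub> (bd M (\<phi> \<sigma>) \<otimes>\<^bsub>G\<^esub> actG M \<sigma> g) = \<one>\<^bsub>G\<^esub>)"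
      using \<phi> g act_one_iff
      by (simp add: delta0_cochain_def one1_def restrict_eq_iff G.m_assoc del: action_simps(2))
    also have "\<dots> \<longleftrightarrow> (\<phi>, g) \<in> Z0 \<Gamma> M"
      using \<phi> g
      by (auto simp: Z0_iff F.mult_inv_eq_one_iff G.inv_solve_left' G.inv_solve_left)
    finally show ?thesis .
  qed
  then show ?thesis
    by (auto simp: Z1.stab_def C0_carrier Z0_iff)
qed

text \<open>In a right action the left factor acts first, so the coboundary split off by
  \<open>F_act_Z0_one_mult\<close> meets the neutral cocycle and fixes it.\<close>

lemma C0_act_one1_F_act:
  assumes c: "c \<in> carrier (C0 \<Gamma> M)" and f: "f \<in> carrier F"
  shows "C0_act_Z1 \<Gamma> M (one1 \<Gamma> M) (F_act_Z0 \<Gamma> M c f) = C0_act_Z1 \<Gamma> M (one1 \<Gamma> M) c"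
proof -
  have "F_act_Z0 \<Gamma> M \<one>\<^bsub>C0 \<Gamma> M\<^esub> f \<in> Z1.stab (one1 \<Gamma> M)"
    using Z0.act_closed[OF one_in_Z0 f] stab_one1 by simp
  then show ?thesis
    using c Z1.act_mult[OF one1_in_Z1] F_act_Z0_one_mult[OF c f] by (simp add: Z1.stab_def)
qed

end

section \<open>Morphisms of crossed modules\<close>

locale xmod_morphism = S: xmod_action \<Gamma> M + T: xmod_action \<Gamma> N
  for \<Gamma> :: "'s top_group" (structure)
    and M :: "('s, 'f1, 'g1) xmod" and N :: "('s, 'f2, 'g2) xmod" +
  fixes e :: "('f1, 'g1, 'f2, 'g2) xmod_mor"
  assumes mor: "is_xmod_mor \<Gamma> M N e"
begin

sublocale eF: group_hom "FF M" "FF N" "onF e"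
  using mor by (intro group_hom.intro group_hom_axioms.intro S.F.is_group T.F.is_group)
    (simp add: is_xmod_mor_def)

sublocale eG: group_hom "GG M" "GG N" "onG e"
  using mor by (intro group_hom.intro group_hom_axioms.intro S.G.is_group T.G.is_group)
    (simp add: is_xmod_mor_def)

lemma equivariant [simp]:
  "\<sigma> \<in> carrier \<Gamma> \<Longrightarrow> f \<in> carrier (FF M) \<Longrightarrow> onF e (actF M \<sigma> f) = actF N \<sigma> (onF e f)"
  "\<sigma> \<in> carrier \<Gamma> \<Longrightarrow> g \<in> carrier (GG M) \<Longrightarrow> onG e (actG M \<sigma> g) = actG N \<sigma> (onG e g)"
  "g \<in> carrier (GG M) \<Longrightarrow> f \<in> carrier (FF M) \<Longrightarrow> onF e (act M g f) = act N (onG e g) (onF e f)"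
  using mor by (simp_all add: is_xmod_mor_def)

lemma onG_bd [simp]: "f \<in> carrier (FF M) \<Longrightarrow> onG e (bd M f) = bd N (onF e f)"
  using mor by (simp add: is_xmod_mor_def)

lemma Hm1_map_defined: "Hm1_map_defined \<Gamma> M N e"
  unfolding Hm1_map_defined_def Hm1_map_def Hm1_def kernel_def
  \<comment> \<open>The rules are reversed so that action and boundary on the image are pulled back
    to the source, where invariance and triviality are known.\<close>
  by (auto simp flip: equivariant onG_bd)

lemma MapsF_push:
  "\<phi> \<in> Maps (opens \<Gamma>) (FF M) \<Longrightarrow> (\<lambda>\<sigma>\<in>carrier \<Gamma>. onF e (\<phi> \<sigma>)) \<in> Maps (opens \<Gamma>) (FF N)"
  using locally_constant_on_apply[OF Maps_locally_constant, of \<phi>]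
  by (intro Maps_restrictI) (auto simp: S.topspace_eq)

lemma MapsG_push:
  "\<psi> \<in> Maps (opens \<Gamma>) (GG M) \<Longrightarrow> (\<lambda>\<sigma>\<in>carrier \<Gamma>. onG e (\<psi> \<sigma>)) \<in> Maps (opens \<Gamma>) (GG N)"
  using locally_constant_on_apply[OF Maps_locally_constant, of \<psi>]
  by (intro Maps_restrictI) (auto simp: S.topspace_eq)

lemma Maps2F_push:
  "h \<in> Maps (prod_topology (opens \<Gamma>) (opens \<Gamma>)) (FF M) \<Longrightarrow>
   (\<lambda>x\<in>carrier \<Gamma> \<times> carrier \<Gamma>. onF e (h x)) \<in> Maps (prod_topology (opens \<Gamma>) (opens \<Gamma>)) (FF N)"
  using locally_constant_on_apply[OF Maps_locally_constant, of h]
  by (intro Maps_restrictI) (auto simp: S.topspace_eq)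

lemma push0_C0: "c \<in> carrier (C0 \<Gamma> M) \<Longrightarrow> push0 \<Gamma> e c \<in> carrier (C0 \<Gamma> N)"
  by (auto simp: S.C0_carrier T.C0_carrier push0_def MapsF_push)

lemma push0_mult:
  assumes "c \<in> carrier (C0 \<Gamma> M)" "c' \<in> carrier (C0 \<Gamma> M)"
  shows "push0 \<Gamma> e (c \<otimes>\<^bsub>C0 \<Gamma> M\<^esub> c') = push0 \<Gamma> e c \<otimes>\<^bsub>C0 \<Gamma> N\<^esub> push0 \<Gamma> e c'"
  using assms
  by (auto simp: S.C0_carrier push0_def S.C0_mult T.C0_mult intro!: restrict_ext)

lemma push0_hom: "push0 \<Gamma> e \<in> hom (C0 \<Gamma> M) (C0 \<Gamma> N)"
  by (intro homI push0_C0 push0_mult)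

lemma push0_one: "push0 \<Gamma> e \<one>\<^bsub>C0 \<Gamma> M\<^esub> = \<one>\<^bsub>C0 \<Gamma> N\<^esub>"
  by (auto simp: S.C0_one T.C0_one push0_def intro!: restrict_ext)

lemma push1_one1: "push1 \<Gamma> e (one1 \<Gamma> M) = one1 \<Gamma> N"
  by (auto simp: one1_def push1_def intro!: restrict_ext)

lemma push0_F_act:
  assumes "c \<in> carrier (C0 \<Gamma> M)" "f \<in> carrier (FF M)"
  shows "push0 \<Gamma> e (F_act_Z0 \<Gamma> M c f) = F_act_Z0 \<Gamma> N (push0 \<Gamma> e c) (onF e f)"
  using assms
  by (auto simp: S.C0_carrier push0_def S.F_act_Z0_eq T.F_act_Z0_eq intro!: restrict_ext)

lemma push1_C0_act:
  assumes "z \<in> Z1 \<Gamma> M" "c \<in> carrier (C0 \<Gamma> M)"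
  shows "push1 \<Gamma> e (C0_act_Z1 \<Gamma> M z c) = C0_act_Z1 \<Gamma> N (push1 \<Gamma> e z) (push0 \<Gamma> e c)"
proof -
  obtain h \<psi> a g where zc: "z = (h, \<psi>)" "c = (a, g)"
    by (cases z, cases c)
  then have "h \<in> Maps (prod_topology (opens \<Gamma>) (opens \<Gamma>)) (FF M)" "\<psi> \<in> Maps (opens \<Gamma>) (GG M)"
    "a \<in> Maps (opens \<Gamma>) (FF M)" "g \<in> carrier (GG M)"
    using assms by (auto simp: S.Z1_iff S.C0_carrier)
  then show ?thesis
    unfolding zc by (auto simp: push0_def push1_def S.C0_act_Z1_eq T.C0_act_Z1_eq intro!: restrict_ext)
qed

lemma push0_Z0:
  assumes "z \<in> Z0 \<Gamma> M"
  shows "push0 \<Gamma> e z \<in> Z0 \<Gamma> N"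
proof -
  obtain \<phi> g where z: "z = (\<phi>, g)" by (cases z)
  have [simp]: "\<phi> \<in> Maps (opens \<Gamma>) (FF M)" "g \<in> carrier (GG M)"
    using assms z by (auto simp: S.Z0_iff)
  have "actG N \<sigma> (onG e g) = inv\<^bsub>GG N\<^esub> (bd N (onF e (\<phi> \<sigma>))) \<otimes>\<^bsub>GG N\<^esub> onG e g"
    if "\<sigma> \<in> carrier \<Gamma>" for \<sigma>
  proof -
    have "actG M \<sigma> g = inv\<^bsub>GG M\<^esub> (bd M (\<phi> \<sigma>)) \<otimes>\<^bsub>GG M\<^esub> g"
      using assms z that by (simp add: S.Z0_iff)
    from arg_cong[OF this, of "onG e"] show ?thesis
      using that by simp
  qed
  then show ?thesis
    using assms unfolding z by (simp add: S.Z0_iff T.Z0_iff push0_def MapsF_push)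
qed

lemma push1_Z1:
  assumes "z \<in> Z1 \<Gamma> M"
  shows "push1 \<Gamma> e z \<in> Z1 \<Gamma> N"
proof -
  obtain h \<psi> where z: "z = (h, \<psi>)" by (cases z)
  have [simp]: "h \<in> Maps (prod_topology (opens \<Gamma>) (opens \<Gamma>)) (FF M)" "\<psi> \<in> Maps (opens \<Gamma>) (GG M)"
    using assms z by (auto simp: S.Z1_iff)
  have "onG e (\<psi> \<sigma>) \<otimes>\<^bsub>GG N\<^esub> actG N \<sigma> (onG e (\<psi> \<tau>)) =
      inv\<^bsub>GG N\<^esub> (bd N (onF e (h (\<sigma>, \<tau>)))) \<otimes>\<^bsub>GG N\<^esub> onG e (\<psi> (\<sigma> \<otimes> \<tau>))"
    if "\<sigma> \<in> carrier \<Gamma>" "\<tau> \<in> carrier \<Gamma>" for \<sigma> \<tau>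
  proof -
    have "\<psi> \<sigma> \<otimes>\<^bsub>GG M\<^esub> actG M \<sigma> (\<psi> \<tau>) = inv\<^bsub>GG M\<^esub> (bd M (h (\<sigma>, \<tau>))) \<otimes>\<^bsub>GG M\<^esub> \<psi> (\<sigma> \<otimes> \<tau>)"
      using assms that by (simp add: z S.Z1_iff)
    from arg_cong[OF this, of "onG e"] show ?thesis
      using that by simp
  qed
  moreover have "onF e (h (\<sigma>, \<tau> \<otimes> \<upsilon>)) \<otimes>\<^bsub>FF N\<^esub> act N (onG e (\<psi> \<sigma>)) (actF N \<sigma> (onF e (h (\<tau>, \<upsilon>)))) =
      onF e (h (\<sigma> \<otimes> \<tau>, \<upsilon>)) \<otimes>\<^bsub>FF N\<^esub> onF e (h (\<sigma>, \<tau>))"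
    if "\<sigma> \<in> carrier \<Gamma>" "\<tau> \<in> carrier \<Gamma>" "\<upsilon> \<in> carrier \<Gamma>" for \<sigma> \<tau> \<upsilon>
  proof -
    have "h (\<sigma>, \<tau> \<otimes> \<upsilon>) \<otimes>\<^bsub>FF M\<^esub> act M (\<psi> \<sigma>) (actF M \<sigma> (h (\<tau>, \<upsilon>))) =
        h (\<sigma> \<otimes> \<tau>, \<upsilon>) \<otimes>\<^bsub>FF M\<^esub> h (\<sigma>, \<tau>)"
      using assms that by (simp add: z S.Z1_iff)
    from arg_cong[OF this, of "onF e"] show ?thesis
      using that by simp
  qed
  ultimately show ?thesis
    unfolding z by (simp add: T.Z1_iff push1_def MapsG_push Maps2F_push)
qed

text \<open>The left side is the set of values in \<open>H0_map\<close> and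
  \<open>H0_map_defined\<close>, so this equation yields both the value and its independence of the
  representative.\<close>

lemma Cl0_push0:
  assumes "z \<in> Z0 \<Gamma> M"
  shows "(\<lambda>z. Cl0 \<Gamma> N (push0 \<Gamma> e z)) ` Cl0 \<Gamma> M z = {Cl0 \<Gamma> N (push0 \<Gamma> e z)}"
proof -
  have "Cl0 \<Gamma> N (push0 \<Gamma> e y) = Cl0 \<Gamma> N (push0 \<Gamma> e z)" if "y \<in> S.Z0.orb z" for y
    using that push0_F_act[of z] T.Z0.orb_act[OF push0_Z0[OF assms]] subsetD[OF S.Z0_subset_C0 assms]
    by (auto simp: S.Z0.orb_def T.Cl0_eq)
  then show ?thesis
    using S.Z0.self_in_orb[OF assms] unfolding S.Cl0_eq by blast
qed

lemma Cl1_push1: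
  assumes "z \<in> Z1 \<Gamma> M"
  shows "(\<lambda>z. Cl1 \<Gamma> N (push1 \<Gamma> e z)) ` Cl1 \<Gamma> M z = {Cl1 \<Gamma> N (push1 \<Gamma> e z)}"
proof -
  have "Cl1 \<Gamma> N (push1 \<Gamma> e y) = Cl1 \<Gamma> N (push1 \<Gamma> e z)" if "y \<in> S.Z1.orb z" for y
  proof -
    from that obtain c where "y = C0_act_Z1 \<Gamma> M z c" "c \<in> carrier (C0 \<Gamma> M)"
      unfolding S.Z1.orb_def by (rule imageE)
    then show ?thesis
      using push1_C0_act[OF assms] T.Z1.orb_act[OF push1_Z1[OF assms] push0_C0]
      by (simp add: T.Cl1_eq)
  qed
  then show ?thesis
    using S.Z1.self_in_orb[OF assms] unfolding S.Cl1_eq by blast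
qed

lemma H0_map_Cl0: "z \<in> Z0 \<Gamma> M \<Longrightarrow> H0_map \<Gamma> N e (Cl0 \<Gamma> M z) = Cl0 \<Gamma> N (push0 \<Gamma> e z)"
  by (simp add: H0_map_def Cl0_push0)

lemma H1_map_Cl1: "z \<in> Z1 \<Gamma> M \<Longrightarrow> H1_map \<Gamma> N e (Cl1 \<Gamma> M z) = Cl1 \<Gamma> N (push1 \<Gamma> e z)"
  by (simp add: H1_map_def Cl1_push1)

lemma H0_map_defined: "H0_map_defined \<Gamma> M N e"
  unfolding H0_map_defined_def H0_def
  using S.Z0.orb_subset push0_Z0 by (auto simp: Cl0_push0 S.Cl0_eq[symmetric] subset_iff)

lemma H1_map_defined: "H1_map_defined \<Gamma> M N e"
  unfolding H1_map_defined_def H1_def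
  using S.Z1.orb_subset push1_Z1 by (auto simp: Cl1_push1 S.Cl1_eq[symmetric] subset_iff)

end

section \<open>Exact sequences of crossed modules\<close>

locale xmod_exact =
  M1: xmod_action \<Gamma> M1 + M2: xmod_action \<Gamma> M2 + M3: xmod_action \<Gamma> M3 +
  i: xmod_morphism \<Gamma> M1 M2 i + j: xmod_morphism \<Gamma> M2 M3 j
  for \<Gamma> :: "'s top_group" (structure)
    and M1 :: "('s, 'f1, 'g1) xmod" and M2 :: "('s, 'f2, 'g2) xmod" and M3 :: "('s, 'f3, 'g3) xmod"
    and i :: "('f1, 'g1, 'f2, 'g2) xmod_mor" and j :: "('f2, 'g2, 'f3, 'g3) xmod_mor" +
  assumes exF: "short_exact (FF M1) (FF M2) (FF M3) (onF i) (onF j)"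
    and exG: "short_exact (GG M1) (GG M2) (GG M3) (onG i) (onG j)"
begin

section \<open>Exactness for cochains and cocycles\<close>

lemma onF_i_inj: "inj_on (onF i) (carrier (FF M1))"
  and onG_i_inj: "inj_on (onG i) (carrier (GG M1))"
  and onF_j_surj: "onF j ` carrier (FF M2) = carrier (FF M3)"
  and onG_j_surj: "onG j ` carrier (GG M2) = carrier (GG M3)"
  and onF_exact: "onF i ` carrier (FF M1) = kernel (FF M2) (FF M3) (onF j)"
  and onG_exact: "onG i ` carrier (GG M1) = kernel (GG M2) (GG M3) (onG j)"
  using exF exG by (auto simp: short_exact_def mon_def epi_def)

lemma onF_comp: "f \<in> carrier (FF M1) \<Longrightarrow> onF j (onF i f) = \<one>\<^bsub>FF M3\<^esub>"
  and onG_comp: "g \<in> carrier (GG M1) \<Longrightarrow> onG j (onG i g) = \<one>\<^bsub>GG M3\<^esub>"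
  using onF_exact onG_exact by (auto simp: kernel_def)

text \<open>A preimage under \<open>onF j\<close> is chosen for each element of \<open>F\<close> of
  the third crossed module, with no regard to group law or action. Composition with a locally
  constant map is still continuous.\<close>

lemma push0_j_surj: "push0 \<Gamma> j ` carrier (C0 \<Gamma> M2) = carrier (C0 \<Gamma> M3)"
proof
  show "push0 \<Gamma> j ` carrier (C0 \<Gamma> M2) \<subseteq> carrier (C0 \<Gamma> M3)"
    using j.push0_C0 by blast
  show "carrier (C0 \<Gamma> M3) \<subseteq> push0 \<Gamma> j ` carrier (C0 \<Gamma> M2)"
  proof
    fix c assume "c \<in> carrier (C0 \<Gamma> M3)"
    then obtain \<phi> g where c: "c = (\<phi>, g)" "\<phi> \<in> Maps (opens \<Gamma>) (FF M3)" "g \<in> carrier (GG M3)"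
      by (auto simp: M3.C0_carrier)
    obtain g' where g': "g' \<in> carrier (GG M2)" "onG j g' = g"
      using c(3) onG_j_surj by (metis imageE)
    have "inv_into (carrier (FF M2)) (onF j) ` carrier (FF M3) \<subseteq> carrier (FF M2)"
      "\<forall>x\<in>carrier (FF M3). onF j (inv_into (carrier (FF M2)) (onF j) x) = x"
      unfolding onF_j_surj[symmetric] by (auto simp: inv_into_into f_inv_into_f)
    moreover have "\<phi> \<in> extensional (topspace (opens \<Gamma>))" "\<phi> \<in> topspace (opens \<Gamma>) \<rightarrow> carrier (FF M3)"
      "locally_constant_on (opens \<Gamma>) \<phi>"
      using c(2) by (auto simp: Maps_iff)
    ultimately obtain \<phi>' where
      "\<phi>' \<in> Maps (opens \<Gamma>) (FF M2)" "(\<lambda>\<sigma>\<in>carrier \<Gamma>. onF j (\<phi>' \<sigma>)) = \<phi>"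
      unfolding M1.topspace_eq[symmetric] by (rule Maps_lift)
    then show "c \<in> push0 \<Gamma> j ` carrier (C0 \<Gamma> M2)"
      using c(1) g' by (intro image_eqI[of _ _ "(\<phi>', g')"]) (auto simp: push0_def M2.C0_carrier)
  qed
qed

lemma push0_i_inj: "inj_on (push0 \<Gamma> i) (carrier (C0 \<Gamma> M1))"
proof (rule inj_onI)
  fix c c' assume "c \<in> carrier (C0 \<Gamma> M1)" "c' \<in> carrier (C0 \<Gamma> M1)" and eq: "push0 \<Gamma> i c = push0 \<Gamma> i c'"
  then obtain \<phi> g \<phi>' g' where c: "c = (\<phi>, g)" "c' = (\<phi>', g')"
    and \<phi>: "\<phi> \<in> Maps (opens \<Gamma>) (FF M1)" "\<phi>' \<in> Maps (opens \<Gamma>) (FF M1)"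
    and g: "g \<in> carrier (GG M1)" "g' \<in> carrier (GG M1)"
    by (auto simp: M1.C0_carrier)
  have "\<phi> \<sigma> = \<phi>' \<sigma>" if "\<sigma> \<in> carrier \<Gamma>" for \<sigma>
    using eq that \<phi> inj_onD[OF onF_i_inj] by (simp add: c push0_def restrict_eq_iff)
  moreover have "g = g'"
    using eq g inj_onD[OF onG_i_inj] by (simp add: c push0_def)
  ultimately show "c = c'"
    using Maps_eqI[OF \<phi>] c M1.topspace_eq by simp
qed

lemma push1_i_inj: "inj_on (push1 \<Gamma> i) (Z1 \<Gamma> M1)"
proof (rule inj_onI)
  fix z z' assume "z \<in> Z1 \<Gamma> M1" "z' \<in> Z1 \<Gamma> M1" and eq: "push1 \<Gamma> i z = push1 \<Gamma> i z'"
  then obtain h \<psi> h' \<psi>' where z: "z = (h, \<psi>)" "z' = (h', \<psi>')"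
    and h: "h \<in> Maps (prod_topology (opens \<Gamma>) (opens \<Gamma>)) (FF M1)"
      "h' \<in> Maps (prod_topology (opens \<Gamma>) (opens \<Gamma>)) (FF M1)"
    and \<psi>: "\<psi> \<in> Maps (opens \<Gamma>) (GG M1)" "\<psi>' \<in> Maps (opens \<Gamma>) (GG M1)"
    by (cases z, cases z') (auto simp: M1.Z1_iff)
  have "\<psi> \<sigma> = \<psi>' \<sigma>" if "\<sigma> \<in> carrier \<Gamma>" for \<sigma>
    using eq that \<psi> inj_onD[OF onG_i_inj] by (simp add: z push1_def restrict_eq_iff)
  then have "\<psi> = \<psi>'"
    using Maps_eqI[OF \<psi>] M1.topspace_eq by simp
  moreover have "h (\<sigma>, \<tau>) = h' (\<sigma>, \<tau>)" if "\<sigma> \<in> carrier \<Gamma>" "\<tau> \<in> carrier \<Gamma>" for \<sigma> \<tau>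
    using eq that h inj_onD[OF onF_i_inj] by (simp add: z push1_def restrict_eq_iff)
  then have "h = h'"
    using Maps_eqI[OF h] M1.topspace_eq by auto
  ultimately show "z = z'"
    using z by simp
qed

lemma push0_comp: "c \<in> carrier (C0 \<Gamma> M1) \<Longrightarrow> push0 \<Gamma> j (push0 \<Gamma> i c) = \<one>\<^bsub>C0 \<Gamma> M3\<^esub>"
  by (auto simp: push0_def M1.C0_carrier M3.C0_one onF_comp onG_comp intro!: restrict_ext)

lemma push1_comp: "z \<in> Z1 \<Gamma> M1 \<Longrightarrow> push1 \<Gamma> j (push1 \<Gamma> i z) = one1 \<Gamma> M3"
  by (cases z) (auto simp: push1_def M1.Z1_iff one1_def onF_comp onG_comp intro!: restrict_ext)

lemma push0_exact: "push0 \<Gamma> i ` carrier (C0 \<Gamma> M1) = kernel (C0 \<Gamma> M2) (C0 \<Gamma> M3) (push0 \<Gamma> j)"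
proof
  show "push0 \<Gamma> i ` carrier (C0 \<Gamma> M1) \<subseteq> kernel (C0 \<Gamma> M2) (C0 \<Gamma> M3) (push0 \<Gamma> j)"
    using i.push0_C0 push0_comp by (auto simp: kernel_def)
  show "kernel (C0 \<Gamma> M2) (C0 \<Gamma> M3) (push0 \<Gamma> j) \<subseteq> push0 \<Gamma> i ` carrier (C0 \<Gamma> M1)"
  proof
    fix c assume c: "c \<in> kernel (C0 \<Gamma> M2) (C0 \<Gamma> M3) (push0 \<Gamma> j)"
    then obtain \<phi> g where \<phi>: "c = (\<phi>, g)" "\<phi> \<in> Maps (opens \<Gamma>) (FF M2)" "g \<in> carrier (GG M2)"
      by (auto simp: M2.C0_carrier kernel_def)
    have one: "onF j (\<phi> \<sigma>) = \<one>\<^bsub>FF M3\<^esub>" if "\<sigma> \<in> topspace (opens \<Gamma>)" for \<sigma>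
      using c that by (simp add: \<phi>(1) kernel_def push0_def M3.C0_one restrict_eq_iff M1.topspace_eq)
    obtain \<phi>' where \<phi>': "\<phi>' \<in> Maps (opens \<Gamma>) (FF M1)" "(\<lambda>\<sigma>\<in>carrier \<Gamma>. onF i (\<phi>' \<sigma>)) = \<phi>"
      using Maps_factor[OF onF_exact \<phi>(2) one] unfolding M1.topspace_eq by blast
    have "g \<in> onG i ` carrier (GG M1)"
      using c \<phi> unfolding onG_exact by (simp add: kernel_def push0_def M3.C0_one)
    then show "c \<in> push0 \<Gamma> i ` carrier (C0 \<Gamma> M1)"
      using \<phi>' \<phi>(1) by (force simp: push0_def M1.C0_carrier)
  qed
qed

text \<open>The cocycle conditions are equations in the first crossed module, and the injective
  equivariant maps \<open>onF i\<close> and \<open>onG i\<close> carry them to the known equations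
  in the second.\<close>

lemma push0_i_reflects_Z0:
  assumes "c \<in> carrier (C0 \<Gamma> M1)" "push0 \<Gamma> i c \<in> Z0 \<Gamma> M2"
  shows "c \<in> Z0 \<Gamma> M1"
proof -
  obtain \<phi> g where c: "c = (\<phi>, g)" by (cases c)
  have [simp]: "\<phi> \<in> Maps (opens \<Gamma>) (FF M1)" "g \<in> carrier (GG M1)"
    using assms c by (auto simp: M1.C0_carrier)
  have "\<phi> (\<sigma> \<otimes> \<tau>) = \<phi> \<sigma> \<otimes>\<^bsub>FF M1\<^esub> actF M1 \<sigma> (\<phi> \<tau>)"
    if "\<sigma> \<in> carrier \<Gamma>" "\<tau> \<in> carrier \<Gamma>" for \<sigma> \<tau>
    using assms(2) that by (intro inj_onD[OF onF_i_inj]) (simp_all add: c M2.Z0_iff push0_def)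
  moreover have "actG M1 \<sigma> g = inv\<^bsub>GG M1\<^esub> (bd M1 (\<phi> \<sigma>)) \<otimes>\<^bsub>GG M1\<^esub> g" if "\<sigma> \<in> carrier \<Gamma>" for \<sigma>
    using assms(2) that by (intro inj_onD[OF onG_i_inj]) (simp_all add: c M2.Z0_iff push0_def)
  ultimately show ?thesis
    by (simp add: c M1.Z0_iff)
qed

lemma push0_exact_Z0: "push0 \<Gamma> i ` Z0 \<Gamma> M1 = {z \<in> Z0 \<Gamma> M2. push0 \<Gamma> j z = \<one>\<^bsub>C0 \<Gamma> M3\<^esub>}"
proof
  show "push0 \<Gamma> i ` Z0 \<Gamma> M1 \<subseteq> {z \<in> Z0 \<Gamma> M2. push0 \<Gamma> j z = \<one>\<^bsub>C0 \<Gamma> M3\<^esub>}"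
    using i.push0_Z0 M1.Z0_subset_C0 push0_comp by blast
  show "{z \<in> Z0 \<Gamma> M2. push0 \<Gamma> j z = \<one>\<^bsub>C0 \<Gamma> M3\<^esub>} \<subseteq> push0 \<Gamma> i ` Z0 \<Gamma> M1"
  proof
    fix z assume z: "z \<in> {z \<in> Z0 \<Gamma> M2. push0 \<Gamma> j z = \<one>\<^bsub>C0 \<Gamma> M3\<^esub>}"
    then have "z \<in> push0 \<Gamma> i ` carrier (C0 \<Gamma> M1)"
      unfolding push0_exact using M2.Z0_subset_C0 by (auto simp: kernel_def)
    then show "z \<in> push0 \<Gamma> i ` Z0 \<Gamma> M1"
      using z push0_i_reflects_Z0 by blast
  qed
qed

text \<open>A cocycle with neutral image takes its values in the kernels of \<open>onF j\<close> and
  \<open>onG j\<close>, so both components factor continuously through \<open>i\<close>. Injectivity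
  of \<open>i\<close> then pulls the cocycle conditions back.\<close>

lemma push1_exact: "push1 \<Gamma> i ` Z1 \<Gamma> M1 = {z \<in> Z1 \<Gamma> M2. push1 \<Gamma> j z = one1 \<Gamma> M3}"
proof
  show "push1 \<Gamma> i ` Z1 \<Gamma> M1 \<subseteq> {z \<in> Z1 \<Gamma> M2. push1 \<Gamma> j z = one1 \<Gamma> M3}"
    using i.push1_Z1 push1_comp by blast
  show "{z \<in> Z1 \<Gamma> M2. push1 \<Gamma> j z = one1 \<Gamma> M3} \<subseteq> push1 \<Gamma> i ` Z1 \<Gamma> M1"
  proof
    fix z assume "z \<in> {z \<in> Z1 \<Gamma> M2. push1 \<Gamma> j z = one1 \<Gamma> M3}"
    then have zZ: "z \<in> Z1 \<Gamma> M2" and zj: "push1 \<Gamma> j z = one1 \<Gamma> M3"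
      by auto
    obtain h \<psi> where z: "z = (h, \<psi>)" by (cases z)
    have h: "h \<in> Maps (prod_topology (opens \<Gamma>) (opens \<Gamma>)) (FF M2)" and \<psi>: "\<psi> \<in> Maps (opens \<Gamma>) (GG M2)"
      using zZ z by (auto simp: M2.Z1_iff)
    have h1: "onF j (h x) = \<one>\<^bsub>FF M3\<^esub>" if "x \<in> topspace (prod_topology (opens \<Gamma>) (opens \<Gamma>))" for x
      using zj that by (auto simp: z push1_def one1_def restrict_eq_iff M1.topspace_eq)
    have \<psi>1: "onG j (\<psi> \<sigma>) = \<one>\<^bsub>GG M3\<^esub>" if "\<sigma> \<in> topspace (opens \<Gamma>)" for \<sigma>
      using zj that by (simp add: z push1_def one1_def restrict_eq_iff M1.topspace_eq)
    obtain h' where h': "h' \<in> Maps (prod_topology (opens \<Gamma>) (opens \<Gamma>)) (FF M1)"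
      "h = (\<lambda>x\<in>carrier \<Gamma> \<times> carrier \<Gamma>. onF i (h' x))"
      using Maps_factor[OF onF_exact h h1] unfolding topspace_prod_topology M1.topspace_eq by metis
    obtain \<psi>' where \<psi>': "\<psi>' \<in> Maps (opens \<Gamma>) (GG M1)" "\<psi> = (\<lambda>\<sigma>\<in>carrier \<Gamma>. onG i (\<psi>' \<sigma>))"
      using Maps_factor[OF onG_exact \<psi> \<psi>1] unfolding M1.topspace_eq by metis
    note [simp] = h'(1) \<psi>'(1)
    have "\<psi>' \<sigma> \<otimes>\<^bsub>GG M1\<^esub> actG M1 \<sigma> (\<psi>' \<tau>) = inv\<^bsub>GG M1\<^esub> (bd M1 (h' (\<sigma>, \<tau>))) \<otimes>\<^bsub>GG M1\<^esub> \<psi>' (\<sigma> \<otimes> \<tau>)"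
      if "\<sigma> \<in> carrier \<Gamma>" "\<tau> \<in> carrier \<Gamma>" for \<sigma> \<tau>
      using zZ that by (intro inj_onD[OF onG_i_inj]) (simp_all add: z h'(2) \<psi>'(2) M2.Z1_iff)
    moreover have "h' (\<sigma>, \<tau> \<otimes> \<upsilon>) \<otimes>\<^bsub>FF M1\<^esub> act M1 (\<psi>' \<sigma>) (actF M1 \<sigma> (h' (\<tau>, \<upsilon>))) =
        h' (\<sigma> \<otimes> \<tau>, \<upsilon>) \<otimes>\<^bsub>FF M1\<^esub> h' (\<sigma>, \<tau>)"
      if "\<sigma> \<in> carrier \<Gamma>" "\<tau> \<in> carrier \<Gamma>" "\<upsilon> \<in> carrier \<Gamma>" for \<sigma> \<tau> \<upsilon>
      using zZ that by (intro inj_onD[OF onF_i_inj]) (simp_all add: z h'(2) \<psi>'(2) M2.Z1_iff)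
    ultimately have "(h', \<psi>') \<in> Z1 \<Gamma> M1"
      by (simp add: M1.Z1_iff)
    then show "z \<in> push1 \<Gamma> i ` Z1 \<Gamma> M1"
      by (rule rev_image_eqI) (simp add: z h'(2) \<psi>'(2) push1_def)
  qed
qed

sublocale E0: exact_actions "FF M1" "Z0 \<Gamma> M1" "F_act_Z0 \<Gamma> M1" "FF M2" "Z0 \<Gamma> M2" "F_act_Z0 \<Gamma> M2"
  "FF M3" "Z0 \<Gamma> M3" "F_act_Z0 \<Gamma> M3" "onF i" "onF j" "push0 \<Gamma> i" "push0 \<Gamma> j"
  "\<one>\<^bsub>C0 \<Gamma> M1\<^esub>" "\<one>\<^bsub>C0 \<Gamma> M2\<^esub>" "\<one>\<^bsub>C0 \<Gamma> M3\<^esub>"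
proof unfold_locales
  show "push0 \<Gamma> i (F_act_Z0 \<Gamma> M1 z f) = F_act_Z0 \<Gamma> M2 (push0 \<Gamma> i z) (onF i f)"
    if "z \<in> Z0 \<Gamma> M1" "f \<in> carrier (FF M1)" for z f
    using i.push0_F_act that M1.Z0_subset_C0 by blast
  show "push0 \<Gamma> j (F_act_Z0 \<Gamma> M2 z f) = F_act_Z0 \<Gamma> M3 (push0 \<Gamma> j z) (onF j f)"
    if "z \<in> Z0 \<Gamma> M2" "f \<in> carrier (FF M2)" for z f
    using j.push0_F_act that M2.Z0_subset_C0 by blast
  show "inj_on (push0 \<Gamma> i) (Z0 \<Gamma> M1)"
    using inj_on_subset[OF push0_i_inj M1.Z0_subset_C0] .
qed (use onF_j_surj onF_exact push0_exact_Z0 i.push0_Z0 j.push0_Z0 M1.one_in_Z0 i.push0_one j.push0_one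
      j.eF.homh in \<open>auto\<close>)

sublocale E1: exact_actions "C0 \<Gamma> M1" "Z1 \<Gamma> M1" "C0_act_Z1 \<Gamma> M1" "C0 \<Gamma> M2" "Z1 \<Gamma> M2" "C0_act_Z1 \<Gamma> M2"
  "C0 \<Gamma> M3" "Z1 \<Gamma> M3" "C0_act_Z1 \<Gamma> M3" "push0 \<Gamma> i" "push0 \<Gamma> j" "push1 \<Gamma> i" "push1 \<Gamma> j"
  "one1 \<Gamma> M1" "one1 \<Gamma> M2" "one1 \<Gamma> M3"
  by unfold_locales
    (use push0_j_surj push0_exact push1_exact i.push1_Z1 j.push1_Z1 M1.one1_in_Z1 i.push1_one1 j.push1_one1
      j.push0_hom push1_i_inj i.push0_C0 i.push1_C0_act j.push1_C0_act in \<open>simp_all\<close>)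

section \<open>The connecting map in degree -1\<close>

lemma orb_Cl: "M1.Z0.orb = Cl0 \<Gamma> M1" "M2.Z0.orb = Cl0 \<Gamma> M2" "M3.Z0.orb = Cl0 \<Gamma> M3"
  "M1.Z1.orb = Cl1 \<Gamma> M1" "M2.Z1.orb = Cl1 \<Gamma> M2" "M3.Z1.orb = Cl1 \<Gamma> M3"
  by (simp_all add: M1.Cl0_eq M2.Cl0_eq M3.Cl0_eq M1.Cl1_eq M2.Cl1_eq M3.Cl1_eq)

lemma H0_H1_simps:
  "carrier (H0 \<Gamma> M) = Cl0 \<Gamma> M ` Z0 \<Gamma> M" "\<one>\<^bsub>H0 \<Gamma> M\<^esub> = Cl0 \<Gamma> M \<one>\<^bsub>C0 \<Gamma> M\<^esub>"
  by (simp_all add: H0_def)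

lemma Hm1_subset: "carrier (Hm1 \<Gamma> M) \<subseteq> carrier (FF M)"
  by (auto simp: Hm1_def kernel_def)

text \<open>The cochain of \<open>deltam1\<close> is the action of the inverse of the chosen lift on the neutral
  element, hence the inverse here.\<close>

lemma connects_m1_iff:
  "f \<in> carrier (FF M2) \<Longrightarrow>
   E0.connects (inv\<^bsub>FF M2\<^esub> f) z \<longleftrightarrow> z \<in> Z0 \<Gamma> M1 \<and> push0 \<Gamma> i z = deltam1_cochain \<Gamma> M2 f"
  by (auto simp: E0.connects_def M2.deltam1_cochain_eq)

text \<open>Any other lift of the same element has an inverse with the same image as the inverse of
  \<open>f\<close>, so \<open>connects_unique\<close> gives the same class.\<close>

lemma deltam1_values_eq:
  assumes f: "f \<in> carrier (FF M2)" and z: "E0.connects (inv\<^bsub>FF M2\<^esub> f) z"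
  shows "deltam1_values \<Gamma> M1 M2 i j (onF j f) = {Cl0 \<Gamma> M1 z}"
proof -
  have "Cl0 \<Gamma> M1 z' = Cl0 \<Gamma> M1 z"
    if "f' \<in> carrier (FF M2)" "onF j f' = onF j f" "E0.connects (inv\<^bsub>FF M2\<^esub> f') z'" for f' z'
    using E0.connects_unique[OF that(3) z] that f by (simp add: orb_Cl)
  then show ?thesis
    using f z unfolding deltam1_values_def lifts_m1_def by (fastforce simp: connects_m1_iff)
qed

lemma deltam1_eq:
  "f \<in> carrier (FF M2) \<Longrightarrow> E0.connects (inv\<^bsub>FF M2\<^esub> f) z \<Longrightarrow>
   deltam1 \<Gamma> M1 M2 i j (onF j f) = Cl0 \<Gamma> M1 z"
  by (simp add: deltam1_def deltam1_values_eq)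

lemma connects_m1_exists:
  assumes f: "f \<in> carrier (FF M2)" and "onF j f \<in> carrier (Hm1 \<Gamma> M3)"
  shows "\<exists>z. E0.connects (inv\<^bsub>FF M2\<^esub> f) z"
  using assms M3.Z0.stab_inv[OF M3.one_in_Z0, of "onF j f"]
  by (intro E0.connects_exists) (simp_all add: M3.stab_one)

lemma Hm1_lift:
  assumes "f3 \<in> carrier (Hm1 \<Gamma> M3)"
  obtains f z where "f \<in> carrier (FF M2)" "f3 = onF j f" "E0.connects (inv\<^bsub>FF M2\<^esub> f) z"
proof -
  have "f3 \<in> onF j ` carrier (FF M2)"
    unfolding onF_j_surj using assms Hm1_subset by (rule rev_subsetD)
  then obtain f where f: "f3 = onF j f" "f \<in> carrier (FF M2)"
    by (rule imageE)
  obtain z where "E0.connects (inv\<^bsub>FF M2\<^esub> f) z"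
    using connects_m1_exists[OF f(2)] f(1) assms by blast
  then show ?thesis
    using that f by simp
qed

lemma deltam1_defined: "deltam1_defined \<Gamma> M1 M2 M3 i j"
  unfolding deltam1_defined_def
proof (intro ballI conjI)
  fix f3 assume f3: "f3 \<in> carrier (Hm1 \<Gamma> M3)"
  obtain f z where f: "f \<in> carrier (FF M2)" "f3 = onF j f" "E0.connects (inv\<^bsub>FF M2\<^esub> f) z"
    using Hm1_lift[OF f3] .
  show "lifts_m1 M2 j f3 \<noteq> {}"
    using f by (auto simp: lifts_m1_def)
  show "is_singleton (deltam1_values \<Gamma> M1 M2 i j f3)"
    using f by (simp add: deltam1_values_eq)
  show "\<exists>z\<in>Z0 \<Gamma> M1. push0 \<Gamma> i z = deltam1_cochain \<Gamma> M2 f'" if "f' \<in> lifts_m1 M2 j f3" for f'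
    using that f3 connects_m1_exists connects_m1_iff unfolding lifts_m1_def by blast
qed

section \<open>Exactness from degree -1 to the middle term of degree 0\<close>

lemma exact_Hm1_M1: "{x \<in> carrier (Hm1 \<Gamma> M1). Hm1_map i x = \<one>\<^bsub>Hm1 \<Gamma> M2\<^esub>} = {\<one>\<^bsub>Hm1 \<Gamma> M1\<^esub>}"
proof -
  have "x = \<one>\<^bsub>FF M1\<^esub>" if "x \<in> carrier (FF M1)" "onF i x = \<one>\<^bsub>FF M2\<^esub>" for x
    using inj_onD[OF onF_i_inj, of x "\<one>\<^bsub>FF M1\<^esub>"] that by simp
  then show ?thesis
    by (auto simp: Hm1_def Hm1_map_def kernel_def)
qed

text \<open>The lemmas of \<open>exact_actions\<close> begin at the stabilizer of the third base
  point, so this place is treated directly: an element killed by \<open>j\<close> comes from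
  \<open>i\<close>, and injectivity of \<open>i\<close> transfers trivial boundary and invariance to
  its preimage.\<close>

lemma exact_Hm1_M2:
  "exact_at (carrier (Hm1 \<Gamma> M1)) (Hm1_map i) (carrier (Hm1 \<Gamma> M2)) (Hm1_map j) (\<one>\<^bsub>Hm1 \<Gamma> M3\<^esub>)"
  unfolding exact_at_def
proof
  show "Hm1_map i ` carrier (Hm1 \<Gamma> M1) \<subseteq> {f \<in> carrier (Hm1 \<Gamma> M2). Hm1_map j f = \<one>\<^bsub>Hm1 \<Gamma> M3\<^esub>}"
    using i.Hm1_map_defined onF_comp Hm1_subset[of M1]
    by (auto simp: Hm1_map_defined_def Hm1_map_def Hm1_def)
  show "{f \<in> carrier (Hm1 \<Gamma> M2). Hm1_map j f = \<one>\<^bsub>Hm1 \<Gamma> M3\<^esub>} \<subseteq> Hm1_map i ` carrier (Hm1 \<Gamma> M1)"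
  proof
    fix f assume "f \<in> {f \<in> carrier (Hm1 \<Gamma> M2). Hm1_map j f = \<one>\<^bsub>Hm1 \<Gamma> M3\<^esub>}"
    then have f: "f \<in> carrier (FF M2)" "bd M2 f = \<one>\<^bsub>GG M2\<^esub>" "\<forall>\<sigma>\<in>carrier \<Gamma>. actF M2 \<sigma> f = f"
      "onF j f = \<one>\<^bsub>FF M3\<^esub>"
      by (auto simp: Hm1_def Hm1_map_def kernel_def)
    obtain k where k: "k \<in> carrier (FF M1)" "f = onF i k"
      using E0.pE[OF f(1,4)] .
    have "bd M1 k = \<one>\<^bsub>GG M1\<^esub>"
      using f k by (intro inj_onD[OF onG_i_inj]) simp_all
    moreover have "actF M1 \<sigma> k = k" if "\<sigma> \<in> carrier \<Gamma>" for \<sigma>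
      using f k that by (intro inj_onD[OF onF_i_inj]) simp_all
    ultimately show "f \<in> Hm1_map i ` carrier (Hm1 \<Gamma> M1)"
      using k by (simp add: Hm1_def Hm1_map_def kernel_def)
  qed
qed

lemma deltam1_trivial_iff:
  assumes "f3 \<in> carrier (Hm1 \<Gamma> M3)"
  shows "deltam1 \<Gamma> M1 M2 i j f3 = \<one>\<^bsub>H0 \<Gamma> M1\<^esub> \<longleftrightarrow> f3 \<in> onF j ` carrier (Hm1 \<Gamma> M2)"
proof -
  obtain f z where f: "f \<in> carrier (FF M2)" "f3 = onF j f" and z: "E0.connects (inv\<^bsub>FF M2\<^esub> f) z"
    using Hm1_lift[OF assms] .
  have "deltam1 \<Gamma> M1 M2 i j f3 = \<one>\<^bsub>H0 \<Gamma> M1\<^esub> \<longleftrightarrow> M1.Z0.orb z = M1.Z0.orb \<one>\<^bsub>C0 \<Gamma> M1\<^esub>"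
    using f z by (simp add: deltam1_eq orb_Cl H0_H1_simps)
  also have "\<dots> \<longleftrightarrow> inv\<^bsub>FF M3\<^esub> f3 \<in> onF j ` carrier (Hm1 \<Gamma> M2)"
    using E0.connects_trivial_iff[OF z] f by (simp add: M2.stab_one)
  also have "\<dots> \<longleftrightarrow> f3 \<in> onF j ` carrier (Hm1 \<Gamma> M2)"
  proof -
    \<comment> \<open>The lift connects through its inverse, so the criterion speaks of the inverse
      of \<open>f3\<close>. The image is closed under inversion because stabilizers are; applying
      this to \<open>f3\<close> and to its inverse gives both directions.\<close>
    have inv: "inv\<^bsub>FF M3\<^esub> x \<in> onF j ` carrier (Hm1 \<Gamma> M2)" if x: "x \<in> onF j ` carrier (Hm1 \<Gamma> M2)" for x
    proof -
      obtain g where g: "x = onF j g" "g \<in> carrier (Hm1 \<Gamma> M2)"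
        using x by (rule imageE)
      then have "inv\<^bsub>FF M2\<^esub> g \<in> carrier (Hm1 \<Gamma> M2)" "inv\<^bsub>FF M3\<^esub> x = onF j (inv\<^bsub>FF M2\<^esub> g)"
        using M2.Z0.stab_inv[OF M2.one_in_Z0] M2.stab_one subsetD[OF Hm1_subset g(2)] by auto
      then show ?thesis by simp
    qed
    show ?thesis
      using inv[of f3] inv[of "inv\<^bsub>FF M3\<^esub> f3"] f by auto
  qed
  finally show ?thesis .
qed

lemma exact_Hm1_M3:
  "exact_at (carrier (Hm1 \<Gamma> M2)) (Hm1_map j) (carrier (Hm1 \<Gamma> M3)) (deltam1 \<Gamma> M1 M2 i j) (\<one>\<^bsub>H0 \<Gamma> M1\<^esub>)"
  using j.Hm1_map_defined deltam1_trivial_iff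
  unfolding exact_at_def Hm1_map_defined_def Hm1_map_def by blast

lemma exact_H0_M1:
  "exact_at (carrier (Hm1 \<Gamma> M3)) (deltam1 \<Gamma> M1 M2 i j) (carrier (H0 \<Gamma> M1)) (H0_map \<Gamma> M2 i) (\<one>\<^bsub>H0 \<Gamma> M2\<^esub>)"
  unfolding exact_at_def
proof
  show "deltam1 \<Gamma> M1 M2 i j ` carrier (Hm1 \<Gamma> M3) \<subseteq>
      {\<xi> \<in> carrier (H0 \<Gamma> M1). H0_map \<Gamma> M2 i \<xi> = \<one>\<^bsub>H0 \<Gamma> M2\<^esub>}"
  proof clarify
    fix f3 assume "f3 \<in> carrier (Hm1 \<Gamma> M3)"
    then obtain f z where f: "f \<in> carrier (FF M2)" "f3 = onF j f" "E0.connects (inv\<^bsub>FF M2\<^esub> f) z"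
      by (rule Hm1_lift)
    then have z: "z \<in> Z0 \<Gamma> M1" "Cl0 \<Gamma> M2 (push0 \<Gamma> i z) = Cl0 \<Gamma> M2 \<one>\<^bsub>C0 \<Gamma> M2\<^esub>"
      using E0.connects_orb_u[OF f(3)] by (auto simp: E0.connects_def orb_Cl)
    then show "deltam1 \<Gamma> M1 M2 i j f3 \<in> carrier (H0 \<Gamma> M1) \<and>
        H0_map \<Gamma> M2 i (deltam1 \<Gamma> M1 M2 i j f3) = \<one>\<^bsub>H0 \<Gamma> M2\<^esub>"
      using f by (simp add: deltam1_eq H0_H1_simps i.H0_map_Cl0)
  qed
  show "{\<xi> \<in> carrier (H0 \<Gamma> M1). H0_map \<Gamma> M2 i \<xi> = \<one>\<^bsub>H0 \<Gamma> M2\<^esub>} \<subseteq>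
      deltam1 \<Gamma> M1 M2 i j ` carrier (Hm1 \<Gamma> M3)"
  proof
    fix \<xi> assume "\<xi> \<in> {\<xi> \<in> carrier (H0 \<Gamma> M1). H0_map \<Gamma> M2 i \<xi> = \<one>\<^bsub>H0 \<Gamma> M2\<^esub>}"
    then obtain z where z: "z \<in> Z0 \<Gamma> M1" "\<xi> = Cl0 \<Gamma> M1 z"
      and triv: "Cl0 \<Gamma> M2 (push0 \<Gamma> i z) = Cl0 \<Gamma> M2 \<one>\<^bsub>C0 \<Gamma> M2\<^esub>"
      by (auto simp: H0_H1_simps i.H0_map_Cl0)
    then obtain f where f: "E0.connects f z"
      using E0.orb_u_trivial_iff[OF z(1)] by (auto simp: orb_Cl)
    then have fc: "f \<in> carrier (FF M2)"
      by (simp add: E0.connects_def)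
    \<comment> \<open>The element that connects to \<open>z\<close> is the inverse of a lift, so the
      preimage of the class is the image of the inverse of \<open>f\<close>.\<close>
    have "onF j (inv\<^bsub>FF M2\<^esub> f) \<in> carrier (Hm1 \<Gamma> M3)"
      using M3.Z0.stab_inv[OF M3.one_in_Z0 E0.connects_stab[OF f]] fc by (simp add: M3.stab_one)
    moreover have "\<xi> = deltam1 \<Gamma> M1 M2 i j (onF j (inv\<^bsub>FF M2\<^esub> f))"
      using deltam1_eq[of "inv\<^bsub>FF M2\<^esub> f" z] f fc z by simp
    ultimately show "\<xi> \<in> deltam1 \<Gamma> M1 M2 i j ` carrier (Hm1 \<Gamma> M3)"
      by blast
  qed
qed

lemma exact_H0_M2:
  "exact_at (carrier (H0 \<Gamma> M1)) (H0_map \<Gamma> M2 i) (carrier (H0 \<Gamma> M2)) (H0_map \<Gamma> M3 j) (\<one>\<^bsub>H0 \<Gamma> M3\<^esub>)"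
proof -
  \<comment> \<open>The kernel is rewritten as the set of classes of certain cocycles, so that the
    criterion for single orbits applies under the image.\<close>
  have "{\<xi> \<in> carrier (H0 \<Gamma> M2). H0_map \<Gamma> M3 j \<xi> = \<one>\<^bsub>H0 \<Gamma> M3\<^esub>} =
      Cl0 \<Gamma> M2 ` {z \<in> Z0 \<Gamma> M2. H0_map \<Gamma> M3 j (Cl0 \<Gamma> M2 z) = \<one>\<^bsub>H0 \<Gamma> M3\<^esub>}"
    unfolding H0_H1_simps(1) by blast
  also have "{z \<in> Z0 \<Gamma> M2. H0_map \<Gamma> M3 j (Cl0 \<Gamma> M2 z) = \<one>\<^bsub>H0 \<Gamma> M3\<^esub>} =
      {z \<in> Z0 \<Gamma> M2. \<exists>y\<in>Z0 \<Gamma> M1. Cl0 \<Gamma> M2 (push0 \<Gamma> i y) = Cl0 \<Gamma> M2 z}"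
    by (rule Collect_cong)
      (simp add: j.H0_map_Cl0 H0_H1_simps E0.orb_v_trivial_iff[unfolded orb_Cl] cong: conj_cong)
  finally have ker: "{\<xi> \<in> carrier (H0 \<Gamma> M2). H0_map \<Gamma> M3 j \<xi> = \<one>\<^bsub>H0 \<Gamma> M3\<^esub>} =
      Cl0 \<Gamma> M2 ` {z \<in> Z0 \<Gamma> M2. \<exists>y\<in>Z0 \<Gamma> M1. Cl0 \<Gamma> M2 (push0 \<Gamma> i y) = Cl0 \<Gamma> M2 z}" .
  have "H0_map \<Gamma> M2 i ` carrier (H0 \<Gamma> M1) = (\<lambda>y. Cl0 \<Gamma> M2 (push0 \<Gamma> i y)) ` Z0 \<Gamma> M1"
    unfolding H0_H1_simps(1) image_image by (rule image_cong) (simp_all add: i.H0_map_Cl0)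
  then show ?thesis
    unfolding exact_at_def ker using i.push0_Z0 by auto
qed

section \<open>The connecting map in degree 0 and exactness up to degree 1\<close>

lemma connects_0_iff:
  "c \<in> carrier (C0 \<Gamma> M2) \<Longrightarrow>
   E1.connects c z \<longleftrightarrow> z \<in> Z1 \<Gamma> M1 \<and> push1 \<Gamma> i z = delta0_cochain \<Gamma> M2 c"
  by (simp add: E1.connects_def M2.delta0_cochain_eq)

lemma lifts_0_iff: "c \<in> lifts_0 \<Gamma> M2 j z3 \<longleftrightarrow> c \<in> carrier (C0 \<Gamma> M2) \<and> push0 \<Gamma> j c = z3"
  by (simp add: lifts_0_def M2.C0_carrier)

text \<open>Changing the representative of a class in \<open>H0 \<Gamma> M3\<close> by \<open>f3\<close> changes the lift by a lift of
  \<open>f3\<close>, which does not affect its action on the neutral cocycle.\<close>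

lemma connects_0_unique:
  assumes c: "E1.connects c z" and c': "E1.connects c' z'"
    and orb: "push0 \<Gamma> j c' \<in> Cl0 \<Gamma> M3 (push0 \<Gamma> j c)"
  shows "Cl1 \<Gamma> M1 z' = Cl1 \<Gamma> M1 z"
proof -
  have cC: "c \<in> carrier (C0 \<Gamma> M2)"
    using c by (simp add: E1.connects_def)
  obtain f3 where f3: "f3 \<in> carrier (FF M3)" "push0 \<Gamma> j c' = F_act_Z0 \<Gamma> M3 (push0 \<Gamma> j c) f3"
    using orb by (auto simp: Cl0_def)
  obtain f where f: "f \<in> carrier (FF M2)" "onF j f = f3"
    using f3(1) onF_j_surj by (metis imageE)
  have "E1.connects (F_act_Z0 \<Gamma> M2 c f) z"
    using c M2.F_act_closed[OF cC f(1)] M2.C0_act_one1_F_act[OF cC f(1)] by (simp add: E1.connects_def)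
  moreover have "push0 \<Gamma> j (F_act_Z0 \<Gamma> M2 c f) = push0 \<Gamma> j c'"
    using j.push0_F_act[OF cC f(1)] f3 f by simp
  ultimately show ?thesis
    using E1.connects_unique c' by (metis orb_Cl(4))
qed

lemma connects_0_exists:
  "c \<in> carrier (C0 \<Gamma> M2) \<Longrightarrow> push0 \<Gamma> j c \<in> Z0 \<Gamma> M3 \<Longrightarrow> \<exists>z. E1.connects c z"
  by (intro E1.connects_exists) (simp_all add: M3.stab_one1)

lemma Z0_lift:
  assumes "z3 \<in> Z0 \<Gamma> M3"
  obtains c z where "c \<in> carrier (C0 \<Gamma> M2)" "z3 = push0 \<Gamma> j c" "E1.connects c z"
proof -
  have "z3 \<in> push0 \<Gamma> j ` carrier (C0 \<Gamma> M2)"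
    unfolding push0_j_surj using assms M3.Z0_subset_C0 by (rule rev_subsetD)
  then obtain c where c: "z3 = push0 \<Gamma> j c" "c \<in> carrier (C0 \<Gamma> M2)"
    by (rule imageE)
  obtain z where "E1.connects c z"
    using connects_0_exists[OF c(2)] c(1) assms by blast
  then show ?thesis
    using that c by simp
qed

lemma delta0_values_eq:
  assumes c: "push0 \<Gamma> j c \<in> Z0 \<Gamma> M3" "E1.connects c z"
  shows "delta0_values \<Gamma> M1 M2 i j (Cl0 \<Gamma> M3 (push0 \<Gamma> j c)) = {Cl1 \<Gamma> M1 z}"
proof
  show "delta0_values \<Gamma> M1 M2 i j (Cl0 \<Gamma> M3 (push0 \<Gamma> j c)) \<subseteq> {Cl1 \<Gamma> M1 z}"
  proof
    fix \<xi> assume "\<xi> \<in> delta0_values \<Gamma> M1 M2 i j (Cl0 \<Gamma> M3 (push0 \<Gamma> j c))"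
    then obtain z' c' where "\<xi> = Cl1 \<Gamma> M1 z'" "push0 \<Gamma> j c' \<in> Cl0 \<Gamma> M3 (push0 \<Gamma> j c)" "E1.connects c' z'"
      unfolding delta0_values_def lifts_0_iff using connects_0_iff by blast
    then show "\<xi> \<in> {Cl1 \<Gamma> M1 z}"
      using connects_0_unique[OF c(2)] by simp
  qed
  have "push0 \<Gamma> j c \<in> Cl0 \<Gamma> M3 (push0 \<Gamma> j c)"
    using M3.Z0.self_in_orb[OF c(1)] by (simp add: orb_Cl)
  moreover have "c \<in> carrier (C0 \<Gamma> M2)"
    using c(2) by (simp add: E1.connects_def)
  ultimately show "{Cl1 \<Gamma> M1 z} \<subseteq> delta0_values \<Gamma> M1 M2 i j (Cl0 \<Gamma> M3 (push0 \<Gamma> j c))"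
    unfolding delta0_values_def lifts_0_iff using connects_0_iff c(2) by blast
qed

lemma delta0_eq:
  "push0 \<Gamma> j c \<in> Z0 \<Gamma> M3 \<Longrightarrow> E1.connects c z \<Longrightarrow>
   delta0 \<Gamma> M1 M2 i j (Cl0 \<Gamma> M3 (push0 \<Gamma> j c)) = Cl1 \<Gamma> M1 z"
  by (simp add: delta0_def delta0_values_eq)

lemma delta0_defined: "delta0_defined \<Gamma> M1 M2 M3 i j"
  unfolding delta0_defined_def
proof (intro ballI conjI)
  fix \<xi> assume "\<xi> \<in> carrier (H0 \<Gamma> M3)"
  then obtain z3 where z3: "z3 \<in> Z0 \<Gamma> M3" "\<xi> = Cl0 \<Gamma> M3 z3"
    by (auto simp: H0_H1_simps)
  show "is_singleton (delta0_values \<Gamma> M1 M2 i j \<xi>)"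
    using Z0_lift[OF z3(1)] z3 by (metis delta0_values_eq is_singletonI)
  fix z3' assume "z3' \<in> \<xi>"
  then have z3': "z3' \<in> Z0 \<Gamma> M3"
    using z3(2) subsetD[OF M3.Z0.orb_subset[OF z3(1)]] by (simp add: orb_Cl)
  show "lifts_0 \<Gamma> M2 j z3' \<noteq> {}"
    using Z0_lift[OF z3'] lifts_0_iff by (metis empty_iff)
  show "\<exists>z\<in>Z1 \<Gamma> M1. push1 \<Gamma> i z = delta0_cochain \<Gamma> M2 c" if "c \<in> lifts_0 \<Gamma> M2 j z3'" for c
    using that z3' connects_0_exists connects_0_iff unfolding lifts_0_iff by blast
qed

text \<open>The criterion is on the level of cocycles, since the stabilizer of the neutral cocycle
  is all of \<open>Z0\<close>: if the class is killed, the given representative itself lifts to a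
  cocycle of the middle crossed module.\<close>

lemma delta0_trivial_iff:
  assumes "push0 \<Gamma> j c \<in> Z0 \<Gamma> M3" "E1.connects c z"
  shows "delta0 \<Gamma> M1 M2 i j (Cl0 \<Gamma> M3 (push0 \<Gamma> j c)) = neutral1 \<Gamma> M1 \<longleftrightarrow>
    push0 \<Gamma> j c \<in> push0 \<Gamma> j ` Z0 \<Gamma> M2"
  using E1.connects_trivial_iff[OF assms(2)] delta0_eq[OF assms]
  by (simp add: neutral1_def orb_Cl M2.stab_one1)

lemma exact_H0_M3:
  "exact_at (carrier (H0 \<Gamma> M2)) (H0_map \<Gamma> M3 j) (carrier (H0 \<Gamma> M3)) (delta0 \<Gamma> M1 M2 i j) (neutral1 \<Gamma> M1)"
  unfolding exact_at_def
proof
  show "H0_map \<Gamma> M3 j ` carrier (H0 \<Gamma> M2) \<subseteq>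
      {\<xi> \<in> carrier (H0 \<Gamma> M3). delta0 \<Gamma> M1 M2 i j \<xi> = neutral1 \<Gamma> M1}"
  proof
    fix \<xi> assume "\<xi> \<in> H0_map \<Gamma> M3 j ` carrier (H0 \<Gamma> M2)"
    then obtain c where c: "c \<in> Z0 \<Gamma> M2" "\<xi> = Cl0 \<Gamma> M3 (push0 \<Gamma> j c)"
      by (auto simp: H0_H1_simps j.H0_map_Cl0)
    then have jc: "push0 \<Gamma> j c \<in> Z0 \<Gamma> M3" "c \<in> carrier (C0 \<Gamma> M2)"
      using j.push0_Z0 M2.Z0_subset_C0 by auto
    then obtain z where "E1.connects c z"
      using connects_0_exists by blast
    then show "\<xi> \<in> {\<xi> \<in> carrier (H0 \<Gamma> M3). delta0 \<Gamma> M1 M2 i j \<xi> = neutral1 \<Gamma> M1}"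
      using delta0_trivial_iff[OF jc(1)] c jc by (simp add: H0_H1_simps)
  qed
  show "{\<xi> \<in> carrier (H0 \<Gamma> M3). delta0 \<Gamma> M1 M2 i j \<xi> = neutral1 \<Gamma> M1} \<subseteq>
      H0_map \<Gamma> M3 j ` carrier (H0 \<Gamma> M2)"
  proof
    fix \<xi> assume "\<xi> \<in> {\<xi> \<in> carrier (H0 \<Gamma> M3). delta0 \<Gamma> M1 M2 i j \<xi> = neutral1 \<Gamma> M1}"
    then obtain z3 where z3: "z3 \<in> Z0 \<Gamma> M3" "\<xi> = Cl0 \<Gamma> M3 z3"
      and triv: "delta0 \<Gamma> M1 M2 i j \<xi> = neutral1 \<Gamma> M1"
      by (auto simp: H0_H1_simps)
    obtain c z where c: "z3 = push0 \<Gamma> j c" "E1.connects c z"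
      using Z0_lift[OF z3(1)] .
    have "z3 \<in> push0 \<Gamma> j ` Z0 \<Gamma> M2"
      using delta0_trivial_iff[OF _ c(2)] triv z3 c(1) by simp
    then obtain c' where c': "z3 = push0 \<Gamma> j c'" "c' \<in> Z0 \<Gamma> M2"
      by (rule imageE)
    then have "\<xi> = H0_map \<Gamma> M3 j (Cl0 \<Gamma> M2 c')"
      using z3 by (simp add: j.H0_map_Cl0)
    then show "\<xi> \<in> H0_map \<Gamma> M3 j ` carrier (H0 \<Gamma> M2)"
      using c' by (simp add: H0_H1_simps)
  qed
qed

lemma exact_H1_M1:
  "exact_at (carrier (H0 \<Gamma> M3)) (delta0 \<Gamma> M1 M2 i j) (H1 \<Gamma> M1) (H1_map \<Gamma> M2 i) (neutral1 \<Gamma> M2)"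
  unfolding exact_at_def
proof
  show "delta0 \<Gamma> M1 M2 i j ` carrier (H0 \<Gamma> M3) \<subseteq>
      {\<xi> \<in> H1 \<Gamma> M1. H1_map \<Gamma> M2 i \<xi> = neutral1 \<Gamma> M2}"
  proof
    fix \<xi> assume "\<xi> \<in> delta0 \<Gamma> M1 M2 i j ` carrier (H0 \<Gamma> M3)"
    then obtain z3 where z3: "z3 \<in> Z0 \<Gamma> M3" "\<xi> = delta0 \<Gamma> M1 M2 i j (Cl0 \<Gamma> M3 z3)"
      by (auto simp: H0_H1_simps)
    obtain c z where c: "z3 = push0 \<Gamma> j c" "E1.connects c z"
      using Z0_lift[OF z3(1)] .
    have z: "z \<in> Z1 \<Gamma> M1"
      using c(2) by (simp add: E1.connects_def)
    have "Cl1 \<Gamma> M2 (push1 \<Gamma> i z) = neutral1 \<Gamma> M2"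
      using E1.connects_orb_u[OF c(2)] by (simp add: orb_Cl neutral1_def)
    with z show "\<xi> \<in> {\<xi> \<in> H1 \<Gamma> M1. H1_map \<Gamma> M2 i \<xi> = neutral1 \<Gamma> M2}"
      using z3 c delta0_eq[OF _ c(2)] by (simp add: i.H1_map_Cl1 H1_def)
  qed
  show "{\<xi> \<in> H1 \<Gamma> M1. H1_map \<Gamma> M2 i \<xi> = neutral1 \<Gamma> M2} \<subseteq>
      delta0 \<Gamma> M1 M2 i j ` carrier (H0 \<Gamma> M3)"
  proof
    fix \<xi> assume "\<xi> \<in> {\<xi> \<in> H1 \<Gamma> M1. H1_map \<Gamma> M2 i \<xi> = neutral1 \<Gamma> M2}"
    then obtain z where z: "z \<in> Z1 \<Gamma> M1" "\<xi> = Cl1 \<Gamma> M1 z"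
      and triv: "Cl1 \<Gamma> M2 (push1 \<Gamma> i z) = Cl1 \<Gamma> M2 (one1 \<Gamma> M2)"
      by (auto simp: H1_def i.H1_map_Cl1 neutral1_def)
    then obtain c where c: "E1.connects c z"
      using E1.orb_u_trivial_iff[OF z(1)] by (auto simp: orb_Cl)
    \<comment> \<open>The cochain \<open>c\<close> was found only as an element moving one neutral
      cocycle to a cocycle from the first crossed module. Its image fixes the neutral cocycle of the
      third, and fixing it is the same as being a cocycle.\<close>
    then have "push0 \<Gamma> j c \<in> Z0 \<Gamma> M3"
      using E1.connects_stab M3.stab_one1 by blast
    then show "\<xi> \<in> delta0 \<Gamma> M1 M2 i j ` carrier (H0 \<Gamma> M3)"
      using delta0_eq[OF _ c] z by (metis H0_H1_simps(1) imageI)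
  qed
qed

lemma exact_H1_M2:
  "exact_at (H1 \<Gamma> M1) (H1_map \<Gamma> M2 i) (H1 \<Gamma> M2) (H1_map \<Gamma> M3 j) (neutral1 \<Gamma> M3)"
proof -
  \<comment> \<open>As in \<open>exact_H0_M2\<close>, the fibre over the neutral class is described
    by cocycles before the orbit criterion is applied.\<close>
  have "{\<xi> \<in> H1 \<Gamma> M2. H1_map \<Gamma> M3 j \<xi> = neutral1 \<Gamma> M3} =
      Cl1 \<Gamma> M2 ` {z \<in> Z1 \<Gamma> M2. H1_map \<Gamma> M3 j (Cl1 \<Gamma> M2 z) = neutral1 \<Gamma> M3}"
    unfolding H1_def by blast
  also have "{z \<in> Z1 \<Gamma> M2. H1_map \<Gamma> M3 j (Cl1 \<Gamma> M2 z) = neutral1 \<Gamma> M3} =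
      {z \<in> Z1 \<Gamma> M2. \<exists>y\<in>Z1 \<Gamma> M1. Cl1 \<Gamma> M2 (push1 \<Gamma> i y) = Cl1 \<Gamma> M2 z}"
    by (rule Collect_cong)
      (simp add: j.H1_map_Cl1 neutral1_def E1.orb_v_trivial_iff[unfolded orb_Cl] cong: conj_cong)
  finally have ker: "{\<xi> \<in> H1 \<Gamma> M2. H1_map \<Gamma> M3 j \<xi> = neutral1 \<Gamma> M3} =
      Cl1 \<Gamma> M2 ` {z \<in> Z1 \<Gamma> M2. \<exists>y\<in>Z1 \<Gamma> M1. Cl1 \<Gamma> M2 (push1 \<Gamma> i y) = Cl1 \<Gamma> M2 z}" .
  have "H1_map \<Gamma> M2 i ` H1 \<Gamma> M1 = (\<lambda>y. Cl1 \<Gamma> M2 (push1 \<Gamma> i y)) ` Z1 \<Gamma> M1"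
    unfolding H1_def image_image by (rule image_cong) (simp_all add: i.H1_map_Cl1)
  then show ?thesis
    unfolding exact_at_def ker using i.push1_Z1 by auto
qed

end

theorem proposition2p16:
  fixes \<Gamma> :: "'s top_group"
    and M1 :: "('s, 'f1, 'g1) xmod"
    and M2 :: "('s, 'f2, 'g2) xmod"
    and M3 :: "('s, 'f3, 'g3) xmod"
    and i :: "('f1, 'g1, 'f2, 'g2) xmod_mor"
    and j :: "('f2, 'g2, 'f3, 'g3) xmod_mor"
  assumes "profinite_group \<Gamma>"
    and "xmod_exact_sequence \<Gamma> M1 M2 M3 i j"
  shows
    "Hm1_map_defined \<Gamma> M1 M2 i \<and> Hm1_map_defined \<Gamma> M2 M3 j \<and>
     deltam1_defined \<Gamma> M1 M2 M3 i j \<and>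
     H0_map_defined \<Gamma> M1 M2 i \<and> H0_map_defined \<Gamma> M2 M3 j \<and>
     delta0_defined \<Gamma> M1 M2 M3 i j \<and>
     H1_map_defined \<Gamma> M1 M2 i \<and> H1_map_defined \<Gamma> M2 M3 j \<and>
     {x \<in> carrier (Hm1 \<Gamma> M1). Hm1_map i x = \<one>\<^bsub>Hm1 \<Gamma> M2\<^esub>} = {\<one>\<^bsub>Hm1 \<Gamma> M1\<^esub>} \<and>
     exact_at (carrier (Hm1 \<Gamma> M1)) (Hm1_map i)
              (carrier (Hm1 \<Gamma> M2)) (Hm1_map j) (\<one>\<^bsub>Hm1 \<Gamma> M3\<^esub>) \<and>
     exact_at (carrier (Hm1 \<Gamma> M2)) (Hm1_map j)
              (carrier (Hm1 \<Gamma> M3)) (deltam1 \<Gamma> M1 M2 i j) (\<one>\<^bsub>H0 \<Gamma> M1\<^esub>) \<and>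
     exact_at (carrier (Hm1 \<Gamma> M3)) (deltam1 \<Gamma> M1 M2 i j)
              (carrier (H0 \<Gamma> M1)) (H0_map \<Gamma> M2 i) (\<one>\<^bsub>H0 \<Gamma> M2\<^esub>) \<and>
     exact_at (carrier (H0 \<Gamma> M1)) (H0_map \<Gamma> M2 i)
              (carrier (H0 \<Gamma> M2)) (H0_map \<Gamma> M3 j) (\<one>\<^bsub>H0 \<Gamma> M3\<^esub>) \<and>
     exact_at (carrier (H0 \<Gamma> M2)) (H0_map \<Gamma> M3 j)
              (carrier (H0 \<Gamma> M3)) (delta0 \<Gamma> M1 M2 i j) (neutral1 \<Gamma> M1) \<and>
     exact_at (carrier (H0 \<Gamma> M3)) (delta0 \<Gamma> M1 M2 i j)
              (H1 \<Gamma> M1) (H1_map \<Gamma> M2 i) (neutral1 \<Gamma> M2) \<and>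
     exact_at (H1 \<Gamma> M1) (H1_map \<Gamma> M2 i)
              (H1 \<Gamma> M2) (H1_map \<Gamma> M3 j) (neutral1 \<Gamma> M3)"
proof -
  interpret xmod_exact \<Gamma> M1 M2 M3 i j
    using assms
    by (simp add: xmod_exact_sequence_def xmod_exact_def xmod_exact_axioms_def xmod_morphism_def
        xmod_morphism_axioms_def xmod_action_def xmod_action_axioms_def)
  show ?thesis
    using i.Hm1_map_defined j.Hm1_map_defined deltam1_defined i.H0_map_defined j.H0_map_defined
      delta0_defined i.H1_map_defined j.H1_map_defined exact_Hm1_M1 exact_Hm1_M2 exact_Hm1_M3
      exact_H0_M1 exact_H0_M2 exact_H0_M3 exact_H1_M1 exact_H1_M2
    by blast
qed

end
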